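(* There are constants $A,B>0$ and $c,C>1$ such that for any positive integer $k$, $Ac^k<m(k)<BC^k$.
   Context: $[n]=\{1,2,\ldots,n\}$. For an integer $n\ge 3$ and two functions $f,g:[n]\to[n]$ without fixed points, the pair $(f,g)$ is realizable in a metric space $(X,d)$ if there are points $A_1,\ldots,A_n\in X$ such that: (i) the distances $d(A_i,A_j)$ are all distinct for different pairs $\{i,j\}$ with $i\ne j$; (ii) for each $i$, $d(A_i,A_{f(i)})<d(A_i,A_j)$ for all $j\ne i,f(i)$; (iii) for each $i$, $d(A_i,A_{g(i)})>d(A_i,A_j)$ for all $j\ne i,g(i)$. The pair $(f,g)$ is realizable if it is realizable in some metric space. $\mathbb{R}^k$ always carries the Euclidean metric. For a positive integer $k$, $m(k)$ denotes the largest integer $n\ge 3$ such that every realizable pair $(f,g)$ of functions $f,g:[n]\to[n]$ is realizable in $\mathbb{R}^k$. *)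

theory Defs
  imports "HOL-Analysis.Analysis"
begin

definition fixfree_map :: "nat \<Rightarrow> (nat \<Rightarrow> nat) \<Rightarrow> bool" where
  "fixfree_map n f \<longleftrightarrow> f \<in> {1..n} \<rightarrow> {1..n} \<and> (\<forall>i\<in>{1..n}. f i \<noteq> i)"

definition realizable_in ::
  "'a set \<Rightarrow> ('a \<Rightarrow> 'a \<Rightarrow> real) \<Rightarrow> nat \<Rightarrow> (nat \<Rightarrow> nat) \<Rightarrow> (nat \<Rightarrow> nat) \<Rightarrow> bool" where
  "realizable_in M d n f g \<longleftrightarrow>
    (\<exists>A. A \<in> {1..n} \<rightarrow> M \<and>
      (\<forall>i\<in>{1..n}. \<forall>j\<in>{1..n}. \<forall>p\<in>{1..n}. \<forall>q\<in>{1..n}.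
         i \<noteq> j \<and> p \<noteq> q \<and> {i, j} \<noteq> {p, q} \<longrightarrow> d (A i) (A j) \<noteq> d (A p) (A q)) \<and>
      (\<forall>i\<in>{1..n}. \<forall>j\<in>{1..n} - {i, f i}. d (A i) (A (f i)) < d (A i) (A j)) \<and>
      (\<forall>i\<in>{1..n}. \<forall>j\<in>{1..n} - {i, g i}. d (A i) (A (g i)) > d (A i) (A j)))"

text \<open>Realizability in some metric space. Quantifying over metric spaces with carrier
  in \<^typ>\<open>nat\<close> is no restriction, because only the finitely many points involved matter;
  see lemma \<open>realizable_inI\<close> below.\<close>

definition realizable :: "nat \<Rightarrow> (nat \<Rightarrow> nat) \<Rightarrow> (nat \<Rightarrow> nat) \<Rightarrow> bool" where
  "realizable n f g \<longleftrightarrow>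
    (\<exists>(M :: nat set) d. Metric_space M d \<and> realizable_in M d n f g)"

lemma realizable_inI:
  fixes M :: "'a set"
  assumes M: "Metric_space M d" and n: "n \<ge> 3" and r: "realizable_in M d n f g"
  shows "realizable n f g"
proof -
  interpret Metric_space M d by (rule M)
  obtain A where A: "A \<in> {1..n} \<rightarrow> M"
    and dist': "\<forall>i\<in>{1..n}. \<forall>j\<in>{1..n}. \<forall>p\<in>{1..n}. \<forall>q\<in>{1..n}.
         i \<noteq> j \<and> p \<noteq> q \<and> {i, j} \<noteq> {p, q} \<longrightarrow> d (A i) (A j) \<noteq> d (A p) (A q)"
    and near: "\<forall>i\<in>{1..n}. \<forall>j\<in>{1..n} - {i, f i}. d (A i) (A (f i)) < d (A i) (A j)"
    and far: "\<forall>i\<in>{1..n}. \<forall>j\<in>{1..n} - {i, g i}. d (A i) (A (g i)) > d (A i) (A j)"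
    using r unfolding realizable_in_def by (elim exE conjE)
  have inj: "i = j" if ij: "i \<in> {1..n}" "j \<in> {1..n}" and eq: "A i = A j" for i j
  proof (rule ccontr)
    assume "i \<noteq> j"
    have "\<not> {1..n} \<subseteq> {i, j}"
    proof
      assume "{1..n} \<subseteq> {i, j}"
      then have "card {1..n} \<le> card {i, j}" by (intro card_mono) simp_all
      with n \<open>i \<noteq> j\<close> show False by simp
    qed
    then obtain p where p: "p \<in> {1..n}" "p \<noteq> i" "p \<noteq> j" by blast
    have "{i, p} \<noteq> {j, p}" using p \<open>i \<noteq> j\<close> by (simp add: doubleton_eq_iff)
    with p have "i \<noteq> p \<and> j \<noteq> p \<and> {i, p} \<noteq> {j, p}" by simp
    with dist'[rule_format, OF ij(1) p(1) ij(2) p(1)]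
    have "d (A i) (A p) \<noteq> d (A j) (A p)" by simp
    with eq show False by simp
  qed
  have "Metric_space {1..n} (\<lambda>i j. d (A i) (A j))"
  proof
    fix x y assume xy: "x \<in> {1..n}" "y \<in> {1..n}"
    then have "A x \<in> M" "A y \<in> M" using A by blast+
    then have "d (A x) (A y) = 0 \<longleftrightarrow> A x = A y" by (rule zero)
    with inj[OF xy] show "d (A x) (A y) = 0 \<longleftrightarrow> x = y" by blast
  next
    fix x y z assume "x \<in> {1..n}" "y \<in> {1..n}" "z \<in> {1..n}"
    then show "d (A x) (A z) \<le> d (A x) (A y) + d (A y) (A z)"
      using A by (intro triangle) blast+
  qed (rule nonneg commute)+
  moreover have "realizable_in {1..n} (\<lambda>i j. d (A i) (A j)) n f g"
    unfolding realizable_in_def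
    by (rule exI[of _ "\<lambda>i. i"], intro conjI dist' near far) simp
  ultimately show ?thesis unfolding realizable_def by blast
qed

text \<open>As in \<^const>\<open>Euclidean_space\<close>, points of k-dimensional space are real sequences
  that vanish from index k on.\<close>

definition euclid_dist :: "nat \<Rightarrow> (nat \<Rightarrow> real) \<Rightarrow> (nat \<Rightarrow> real) \<Rightarrow> real" where
  "euclid_dist k x y = L2_set (\<lambda>i. x i - y i) {..<k}"

lemma Metric_space_euclid:
  "Metric_space (topspace (Euclidean_space k)) (euclid_dist k)"
proof
  fix x y z :: "nat \<Rightarrow> real"
  show "0 \<le> euclid_dist k x y"
    by (simp add: euclid_dist_def)
  show "euclid_dist k x y = euclid_dist k y x"
    by (simp add: euclid_dist_def L2_set_def power2_commute)
  show "euclid_dist k x z \<le> euclid_dist k x y + euclid_dist k y z"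
    using L2_set_triangle_ineq[of "\<lambda>i. x i - y i" "\<lambda>i. y i - z i" "{..<k}"]
    by (simp add: euclid_dist_def)
next
  fix x y assume "x \<in> topspace (Euclidean_space k)" "y \<in> topspace (Euclidean_space k)"
  then have "x i = y i" if "i \<ge> k" for i
    using that by (simp add: topspace_Euclidean_space)
  then have "(\<forall>i<k. x i = y i) \<longleftrightarrow> x = y"
    by (auto simp: fun_eq_iff) (meson not_less)
  then show "euclid_dist k x y = 0 \<longleftrightarrow> x = y"
    by (auto simp: euclid_dist_def L2_set_eq_0_iff)
qed

definition all_realizable_in_Rk :: "nat \<Rightarrow> nat \<Rightarrow> bool" where
  "all_realizable_in_Rk k n \<longleftrightarrow>
    n \<ge> 3 \<and>
    (\<forall>f g. fixfree_map n f \<and> fixfree_map n g \<and> realizable n f g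
       \<longrightarrow> realizable_in (topspace (Euclidean_space k)) (euclid_dist k) n f g)"

text \<open>\<^term>\<open>GREATEST n. P n\<close> is unspecified if no largest such n exists, so
  results about \<open>m\<close> should also establish that the maximum is attained.\<close>

definition m :: "nat \<Rightarrow> nat" where
  "m k = (GREATEST n. all_realizable_in_Rk k n)"

end

theory Submission
  imports Defs
begin

text \<open>
  Upper bound. Take for \<open>f\<close> a star: the point 1 is nearest to all the others. This is realizable in
  a metric space, since any distances between \<open>L\<close> and \<open>2 L\<close> satisfy the triangle inequality
  (\<open>realizable_star\<close>). In Euclidean space, the directions from the centre of a star to the other
  points make pairwise angles of at least 60 degrees, so they are unit vectors at mutual distance
  at least 1. Scaled by \<open>sqrt k\<close> and rounded down, such vectors become distinct integer vectors of
  \<open>l1\<close>-norm at most \<open>2 k\<close>, of which there are at most \<open>12 ^ k\<close>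
  (\<open>card_separated_unit_vectors_le\<close>).

  Lower bound. A realizable pair determines an order on the pairs of points, and it is to be imitated
  by unit vectors in dimension \<open>O(log n)\<close>. For unit vectors a larger inner product means a
  smaller distance, so it suffices to prescribe inner products. Call a pair
  \<open>{i, f i}\<close> an \<open>f\<close>-edge and \<open>{i, g i}\<close> a \<open>g\<close>-edge. If no edge is of both kinds, it is enough that
  \<open>f\<close>-edges have clearly positive and \<open>g\<close>-edges clearly negative inner products, both
  ordered as in the given metric space, while all other inner products are close to 0. An edge of
  both kinds joins some \<open>p\<close> with \<open>g (f p) = p\<close> to \<open>q = f p\<close>; by \<open>source_unique\<close> there is at most
  one. All distances from \<open>p\<close> are then at least that of \<open>p\<close> and \<open>q\<close>, and all distances from \<open>q\<close>
  are at most that, which is met by the value 0 on that edge, and values of intermediate size,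
  negative on the remaining edges at \<open>p\<close> and positive on those at \<open>q\<close> (\<open>weight_nearest\<close>).

  Along a long chain \<open>i, f i, f (f i), ...\<close> the distances must decrease, so the inner products on
  the prescribed edges have to be exact, whereas approximate values suffice elsewhere. The graph of
  prescribed edges can be oriented with at most four edges leaving each vertex. Hence every subset
  contains a vertex with at most eight neighbours in the subset, and the vectors can be
  chosen one at a time, each with at most eight exact constraints (\<open>exists_points_prescribed_ip\<close>).
  For the new vector, some normalized sign vector is nearly orthogonal to exponentially many given
  vectors (\<open>exists_nearly_orthogonal\<close>), and the constraints are met by a correction inside the span of the
  at most eight neighbours (\<open>extend_prescribed_ip\<close>). As the prescribed values are of size
  \<open>\<delta> = 1 / 320\<close>, the correction disturbs the other inner products only by \<open>O(\<delta>\<^sup>2)\<close>, which is small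
  in comparison with \<open>\<delta>\<close>. Finally a small perturbation makes all distances
  distinct (\<open>realizable_in_Rk_if_nearest_farthest\<close>).
\<close>

section \<open>Inner products of coordinate sequences\<close>

definition ip :: "nat \<Rightarrow> (nat \<Rightarrow> real) \<Rightarrow> (nat \<Rightarrow> real) \<Rightarrow> real" where
  "ip k x y = (\<Sum>l<k. x l * y l)"

lemma ip_commute: "ip k x y = ip k y x"
  by (simp add: ip_def mult.commute)

lemma ip_add_left: "ip k (\<lambda>l. x l + y l) z = ip k x z + ip k y z"
  by (simp add: ip_def algebra_simps sum.distrib)

lemma ip_diff_left: "ip k (\<lambda>l. x l - y l) z = ip k x z - ip k y z"
  by (simp add: ip_def algebra_simps sum_subtractf)

lemma ip_scale_left: "ip k (\<lambda>l. c * x l) z = c * ip k x z"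
  by (simp add: ip_def sum_distrib_left mult.assoc)

lemma ip_sum_left: "ip k (\<lambda>l. \<Sum>m\<in>N. c m * x m l) z = (\<Sum>m\<in>N. c m * ip k (x m) z)"
proof -
  have "ip k (\<lambda>l. \<Sum>m\<in>N. c m * x m l) z = (\<Sum>l<k. \<Sum>m\<in>N. c m * x m l * z l)"
    by (simp add: ip_def sum_distrib_right)
  also have "\<dots> = (\<Sum>m\<in>N. \<Sum>l<k. c m * x m l * z l)"
    by (rule sum.swap)
  finally show ?thesis
    by (simp add: ip_def sum_distrib_left mult.assoc)
qed

lemma ip_nonneg: "0 \<le> ip k x x"
  by (simp add: ip_def sum_nonneg)

definition sqdist :: "nat \<Rightarrow> (nat \<Rightarrow> real) \<Rightarrow> (nat \<Rightarrow> real) \<Rightarrow> real" where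
  "sqdist k x y = (\<Sum>l<k. (x l - y l)\<^sup>2)"

lemma sqdist_eq_ip: "sqdist k x y = ip k x x + ip k y y - 2 * ip k x y"
  by (simp add: sqdist_def ip_def power2_eq_square algebra_simps sum.distrib sum_subtractf
      sum_distrib_left)

lemma euclid_dist_eq_sqrt: "euclid_dist k x y = sqrt (sqdist k x y)"
  by (simp add: euclid_dist_def L2_set_def sqdist_def)

section \<open>Packing\<close>

lemma sum_half_power_abs_le: "(\<Sum>z\<in>{- int M..int M}. (1/2::real) ^ nat \<bar>z\<bar>) \<le> 3"
proof -
  have "(\<Sum>z\<in>{- int M..int M}. (1/2::real) ^ nat \<bar>z\<bar>) = 3 - 2 / 2 ^ M" for M
  proof (induction M)
    case 0
    show ?case by simp
  next
    case (Suc M)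
    have "{- int (Suc M)..int (Suc M)} = insert (int (Suc M)) (insert (- int (Suc M)) {- int M..int M})"
      by auto
    then have "(\<Sum>z\<in>{- int (Suc M)..int (Suc M)}. (1/2::real) ^ nat \<bar>z\<bar>)
      = (\<Sum>z\<in>{- int M..int M}. (1/2) ^ nat \<bar>z\<bar>) + 2 * (1/2) ^ Suc M"
      by (simp add: nat_add_distrib)
    then show ?case
      unfolding Suc by (simp add: field_simps)
  qed
  then show ?thesis by simp
qed

text \<open>Give the integer vector \<open>z\<close> the weight \<open>2 ^ - (\<bar>z 0\<bar> + ... + \<bar>z (k - 1)\<bar>)\<close>. The total weight
  of all integer vectors is \<open>3 ^ k\<close>, and each vector counted here has weight at least \<open>4 ^ - k\<close>.\<close>
lemma card_bounded_l1_le: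
  fixes Z :: "(nat \<Rightarrow> int) set"
  assumes ext: "\<And>z. z \<in> Z \<Longrightarrow> z \<in> extensional {..<k}"
    and l1: "\<And>z. z \<in> Z \<Longrightarrow> (\<Sum>l<k. nat \<bar>z l\<bar>) \<le> 2 * k"
  shows "finite Z \<and> card Z \<le> 12 ^ k"
proof -
  define B where "B = PiE {..<k} (\<lambda>_. {- int (2*k)..int (2*k)})"
  have finB: "finite B" unfolding B_def by (intro finite_PiE) auto
  have sub: "Z \<subseteq> B"
  proof
    fix z assume z: "z \<in> Z"
    have "z l \<in> {- int (2*k)..int (2*k)}" if "l < k" for l
    proof -
      have "nat \<bar>z l\<bar> \<le> (\<Sum>l<k. nat \<bar>z l\<bar>)"
        using that by (intro member_le_sum) auto
      with l1[OF z] show ?thesis by auto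
    qed
    then show "z \<in> B" using ext[OF z] by (auto simp: B_def PiE_def)
  qed
  have finZ: "finite Z" using sub finB by (rule finite_subset)
  have weight: "(1::real) \<le> 4 ^ k * (\<Prod>l<k. (1/2) ^ nat \<bar>z l\<bar>)" if "z \<in> Z" for z
  proof -
    have "(1/2::real) ^ (2*k) \<le> (1/2) ^ (\<Sum>l<k. nat \<bar>z l\<bar>)"
      using l1[OF that] by (intro power_decreasing) auto
    then have "(4::real) ^ k * (1/2) ^ (2*k) \<le> 4 ^ k * (1/2) ^ (\<Sum>l<k. nat \<bar>z l\<bar>)"
      by (intro mult_left_mono) auto
    moreover have "(4::real) ^ k * (1/2) ^ (2*k) = 1"
      by (simp add: power_mult power2_eq_square power_one_over)
    ultimately show ?thesis by (simp add: power_sum)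
  qed
  have "real (card Z) = (\<Sum>z\<in>Z. 1)" by simp
  also have "\<dots> \<le> (\<Sum>z\<in>Z. 4 ^ k * (\<Prod>l<k. (1/2) ^ nat \<bar>z l\<bar>))"
    using weight by (rule sum_mono)
  also have "\<dots> \<le> (\<Sum>z\<in>B. 4 ^ k * (\<Prod>l<k. (1/2) ^ nat \<bar>z l\<bar>))"
    using sub finB by (intro sum_mono2) (auto intro!: mult_nonneg_nonneg prod_nonneg)
  also have "\<dots> = 4 ^ k * (\<Prod>l<k. \<Sum>z\<in>{- int (2*k)..int (2*k)}. (1/2) ^ nat \<bar>z\<bar>)"
    unfolding B_def by (subst prod_sum_PiE) (auto simp: sum_distrib_left)
  also have "\<dots> \<le> 4 ^ k * (\<Prod>l<k. 3)"
    by (intro mult_left_mono prod_mono) (use sum_half_power_abs_le[of "2*k"] in \<open>auto intro!: sum_nonneg\<close>)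
  also have "\<dots> = 12 ^ k" by (simp flip: power_mult_distrib)
  finally have "real (card Z) \<le> real (12 ^ k)" by simp
  with finZ show ?thesis by (simp only: of_nat_le_iff) 
qed

text \<open>Vectors with the same coordinates after rounding down to multiples of \<open>1 / sqrt k\<close> are at distance less
  than 1, so rounding is injective. The \<open>l1\<close>-norm of a unit vector is at most \<open>sqrt k\<close>, and
  rounding adds at most 1 in each of the \<open>k\<close> coordinates.\<close>
lemma card_separated_unit_vectors_le:
  fixes u :: "'a \<Rightarrow> nat \<Rightarrow> real"
  assumes "k \<ge> 1"
    and unit: "\<And>i. i \<in> S \<Longrightarrow> ip k (u i) (u i) = 1"
    and sep: "\<And>i j. i \<in> S \<Longrightarrow> j \<in> S \<Longrightarrow> i \<noteq> j \<Longrightarrow> sqdist k (u i) (u j) \<ge> 1"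
  shows "card S \<le> 12 ^ k"
proof -
  define z where "z i = (\<lambda>l\<in>{..<k}. \<lfloor>sqrt k * u i l\<rfloor>)" for i
  have "inj_on z S"
  proof (rule inj_onI, rule ccontr)
    fix i j assume ij: "i \<in> S" "j \<in> S" "z i = z j" "i \<noteq> j"
    have "(u i l - u j l)\<^sup>2 < 1 / k" if "l < k" for l
    proof -
      have "\<lfloor>sqrt k * u i l\<rfloor> = \<lfloor>sqrt k * u j l\<rfloor>"
        using fun_cong[OF ij(3), of l] that by (simp add: z_def)
      then have "\<bar>sqrt k * u i l - sqrt k * u j l\<bar> < 1" by linarith
      then have "\<bar>sqrt k * (u i l - u j l)\<bar> < 1"
        by (simp add: right_diff_distrib)
      then have "(sqrt k * (u i l - u j l))\<^sup>2 < 1"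
        by (simp add: abs_square_less_1)
      then show ?thesis using \<open>k \<ge> 1\<close> by (simp add: power_mult_distrib pos_less_divide_eq mult.commute)
    qed
    then have "sqdist k (u i) (u j) < (\<Sum>l<k. 1 / k)"
      unfolding sqdist_def using \<open>k \<ge> 1\<close> by (intro sum_strict_mono) (auto simp: lessThan_empty_iff)
    with sep[OF ij(1,2,4)] \<open>k \<ge> 1\<close> show False by simp
  qed
  moreover have "finite (z ` S) \<and> card (z ` S) \<le> 12 ^ k"
  proof (rule card_bounded_l1_le)
    fix y assume "y \<in> z ` S"
    then obtain i where i: "i \<in> S" "y = z i" by blast
    then show "y \<in> extensional {..<k}" by (simp add: z_def)
    have "real (nat \<bar>z i l\<bar>) \<le> (k * (u i l)\<^sup>2 + 3) / 2" if "l < k" for l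
    proof -
      have "real (nat \<bar>z i l\<bar>) \<le> \<bar>sqrt k * u i l\<bar> + 1"
        using that by (simp add: z_def) linarith
      \<comment> \<open>Summed over \<open>l\<close>, this replaces the Cauchy--Schwarz inequality.\<close>
      also have "\<bar>sqrt k * u i l\<bar> \<le> (\<bar>sqrt k * u i l\<bar>\<^sup>2 + 1) / 2"
        using sum_squares_bound[of "\<bar>sqrt k * u i l\<bar>" 1] by simp
      finally show ?thesis by (simp add: power_mult_distrib field_simps)
    qed
    then have "(\<Sum>l<k. real (nat \<bar>z i l\<bar>)) \<le> (\<Sum>l<k. (k * (u i l)\<^sup>2 + 3) / 2)"
      by (intro sum_mono) auto
    also have "\<dots> = (k * ip k (u i) (u i) + 3 * k) / 2"
      by (simp add: ip_def sum.distrib power2_eq_square sum_distrib_left flip: sum_divide_distrib)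
    also have "\<dots> = 2 * k" using unit[OF i(1)] by simp
    finally have "real (\<Sum>l<k. nat \<bar>z i l\<bar>) \<le> real (2 * k)" by simp
    then show "(\<Sum>l<k. nat \<bar>y l\<bar>) \<le> 2 * k" unfolding i(2) by (simp only: of_nat_le_iff)
  qed
  ultimately show ?thesis by (simp add: card_image)
qed

section \<open>Stars\<close>

text \<open>A metric that compares pairs lexicographically, smaller index first. The summand \<open>(n + 1)\<^sup>2\<close>
  exceeds the rest, which makes the triangle inequality automatic. For every point, the
  nearest other point is then the one of smallest index, and the farthest the one of largest index.\<close>
definition lex_dist :: "nat \<Rightarrow> nat \<Rightarrow> nat \<Rightarrow> real" where
  "lex_dist n i j = (if i = j then 0 else real ((n + 1)\<^sup>2 + min i j * (n + 1) + max i j))"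

lemma Metric_space_lex_dist: "Metric_space {1..n} (lex_dist n)"
proof
  fix x y z :: nat assume xyz: "x \<in> {1..n}" "y \<in> {1..n}" "z \<in> {1..n}"
  have lower: "(n + 1)\<^sup>2 \<le> lex_dist n i j" if "i \<noteq> j" for i j
    using that by (simp add: lex_dist_def)
  have upper: "lex_dist n i j \<le> 2 * (n + 1)\<^sup>2" if ij: "i \<in> {1..n}" "j \<in> {1..n}" for i j
  proof (cases "i = j")
    case False
    then have "min i j + 1 \<le> n" "max i j \<le> n" using ij by auto
    then have "(min i j + 1) * (n + 1) \<le> n * (n + 1)" by (intro mult_right_mono) auto
    then have "min i j * (n + 1) + max i j \<le> (n + 1)\<^sup>2" using \<open>max i j \<le> n\<close>
      by (simp add: power2_eq_square algebra_simps del: max.bounded_iff)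
    then have "real ((n + 1)\<^sup>2 + min i j * (n + 1) + max i j) \<le> real (2 * (n + 1)\<^sup>2)"
      by (subst of_nat_le_iff) simp
    then show ?thesis using False by (simp add: lex_dist_def)
  qed (simp add: lex_dist_def)
  have "0 < (n + 1)\<^sup>2" by simp
  with lower[of x y] have "x \<noteq> y \<Longrightarrow> 0 < lex_dist n x y" by linarith
  then show "lex_dist n x y = 0 \<longleftrightarrow> x = y"
    by (cases "x = y") (auto simp: lex_dist_def)
  show "lex_dist n x z \<le> lex_dist n x y + lex_dist n y z"
  proof (cases "x = y \<or> y = z")
    case True
    then show ?thesis by (auto simp: lex_dist_def)
  next
    case False
    then show ?thesis using lower[of x y] lower[of y z] upper[OF xyz(1,3)] by linarith
  qed
qed (auto simp: lex_dist_def min.commute max.commute)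

lemma lex_less:
  fixes a b c e n :: nat
  assumes "a < c \<or> a = c \<and> b < e" "b \<le> n"
  shows "a * (n + 1) + b < c * (n + 1) + e"
proof (cases "a = c")
  case False
  then have "(a + 1) * (n + 1) \<le> c * (n + 1)" using assms(1) by (intro mult_right_mono) auto
  with assms(2) show ?thesis by (simp add: algebra_simps)
qed (use assms in auto)

definition star_near :: "nat \<Rightarrow> nat" where
  "star_near i = (if i = 1 then 2 else 1)"

definition star_far :: "nat \<Rightarrow> nat \<Rightarrow> nat" where
  "star_far n i = (if i = n then n - 1 else n)"

lemma lex_dist_less:
  assumes "i \<noteq> j" "p \<noteq> q" "max i j \<le> n"
    and "min i j < min p q \<or> min i j = min p q \<and> max i j < max p q"
  shows "lex_dist n i j < lex_dist n p q"
proof -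
  have "(n + 1)\<^sup>2 + min i j * (n + 1) + max i j < (n + 1)\<^sup>2 + min p q * (n + 1) + max p q"
    using lex_less[OF assms(4,3)] by simp
  then show ?thesis using assms(1,2) by (simp only: lex_dist_def if_False of_nat_less_iff)
qed

lemma realizable_star:
  assumes n: "n \<ge> 3"
  shows "realizable n star_near (star_far n)"
proof (rule realizable_inI[OF Metric_space_lex_dist[of n] n])
  show "realizable_in {1..n} (lex_dist n) n star_near (star_far n)"
    unfolding realizable_in_def
  proof (intro exI[of _ "\<lambda>i. i"] conjI ballI impI)
    fix i j p q
    assume ij: "i \<in> {1..n}" "j \<in> {1..n}" "p \<in> {1..n}" "q \<in> {1..n}"
      and ne: "i \<noteq> j \<and> p \<noteq> q \<and> {i, j} \<noteq> {p, q}"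
    then have "min i j \<noteq> min p q \<or> max i j \<noteq> max p q"
      by (auto simp: doubleton_eq_iff min_def max_def split: if_splits)
    then have "min i j < min p q \<or> min i j = min p q \<and> max i j < max p q \<or>
      min p q < min i j \<or> min p q = min i j \<and> max p q < max i j" by linarith
    then have "lex_dist n i j < lex_dist n p q \<or> lex_dist n p q < lex_dist n i j"
      using lex_dist_less[of i j p q n] lex_dist_less[of p q i j n] ij ne by auto
    then show "lex_dist n i j \<noteq> lex_dist n p q" by auto
  next
    fix i j assume "i \<in> {1..n}" "j \<in> {1..n} - {i, star_near i}"
    then show "lex_dist n i (star_near i) < lex_dist n i j"
      using n by (intro lex_dist_less) (auto simp: star_near_def min_def max_def)
  next
    fix i j assume "i \<in> {1..n}" "j \<in> {1..n} - {i, star_far n i}"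
    then show "lex_dist n i (star_far n i) > lex_dist n i j"
      using n by (intro lex_dist_less) (auto simp: star_far_def min_def max_def)
  qed auto
qed

lemma fixfree_star: "n \<ge> 3 \<Longrightarrow> fixfree_map n star_near" "n \<ge> 3 \<Longrightarrow> fixfree_map n (star_far n)"
  by (auto simp: fixfree_map_def star_near_def star_far_def)

section \<open>Points with a common nearest point\<close>

text \<open>In the triangle formed by \<open>c\<close> and two of the points, the side opposite to \<open>c\<close> is the
  longest, so the angle at \<open>c\<close> is at least 60 degrees.\<close>
lemma card_common_nearest_le:
  fixes x :: "nat \<Rightarrow> nat \<Rightarrow> real"
  assumes k: "k \<ge> 1"
    and pos: "\<And>i. i \<in> S \<Longrightarrow> sqdist k (x i) c > 0"
    and near: "\<And>i j. i \<in> S \<Longrightarrow> j \<in> S \<Longrightarrow> i \<noteq> j \<Longrightarrow> sqdist k (x i) c < sqdist k (x i) (x j)"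
  shows "card S \<le> 12 ^ k"
proof -
  define y where "y i l = x i l - c l" for i l
  define r where "r i = sqrt (ip k (y i) (y i))" for i
  define u where "u i l = (1 / r i) * y i l" for i l
  have y_c: "ip k (y i) (y i) = sqdist k (x i) c" for i
    by (simp add: ip_def sqdist_def y_def power2_eq_square)
  have r_pos: "r i > 0" and r_sq: "ip k (y i) (y i) = r i * r i" if "i \<in> S" for i
    using pos[OF that] by (simp_all add: r_def y_c)
  have ip_u: "ip k (u i) (u j) = ip k (y i) (y j) / (r i * r j)" for i j
    unfolding u_def ip_scale_left
    by (subst ip_commute, subst ip_scale_left, subst ip_commute) simp
  have angle: "2 * ip k (y i) (y j) \<le> r i * r j"
    if "i \<in> S" "j \<in> S" "i \<noteq> j" "r j \<le> r i" for i j
  proof -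
    have "sqdist k (x i) (x j) = sqdist k (y i) (y j)"
      by (simp add: sqdist_def y_def)
    then have "r i * r i < r i * r i + r j * r j - 2 * ip k (y i) (y j)"
      using near[OF that(1-3)] that(1,2) by (simp add: sqdist_eq_ip[of k "y i"] r_sq flip: y_c)
    moreover have "r j * r j \<le> r i * r j"
      using that r_pos[of j] by (intro mult_right_mono) auto
    ultimately show ?thesis by linarith
  qed
  show ?thesis
  proof (rule card_separated_unit_vectors_le[OF k, of S u])
    show unit: "ip k (u i) (u i) = 1" if "i \<in> S" for i
      using r_pos[OF that] r_sq[OF that] by (simp add: ip_u)
    fix i j assume ij: "i \<in> S" "j \<in> S" "i \<noteq> j"
    have "2 * ip k (y i) (y j) \<le> r i * r j"
      using angle[of i j] angle[of j i] ij by (cases "r j \<le> r i") (auto simp: ip_commute mult.commute)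
    then have "2 * ip k (u i) (u j) \<le> 1"
      using r_pos[OF ij(1)] r_pos[OF ij(2)] by (simp add: ip_u)
    then show "1 \<le> sqdist k (u i) (u j)"
      by (simp add: sqdist_eq_ip unit ij)
  qed
qed

lemma all_realizable_in_Rk_le:
  assumes k: "k \<ge> 1" and "all_realizable_in_Rk k n"
  shows "n \<le> 12 ^ k + 1"
proof -
  have n: "n \<ge> 3" and "realizable_in (topspace (Euclidean_space k)) (euclid_dist k) n star_near (star_far n)"
    using assms(2) fixfree_star realizable_star unfolding all_realizable_in_Rk_def by blast+
  then obtain A where distinct: "\<And>i j p q. \<lbrakk>i \<in> {1..n}; j \<in> {1..n}; p \<in> {1..n}; q \<in> {1..n};
         i \<noteq> j \<and> p \<noteq> q \<and> {i, j} \<noteq> {p, q}\<rbrakk> \<Longrightarrow> euclid_dist k (A i) (A j) \<noteq> euclid_dist k (A p) (A q)"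
    and near: "\<And>i j. \<lbrakk>i \<in> {1..n}; j \<in> {1..n} - {i, star_near i}\<rbrakk>
        \<Longrightarrow> euclid_dist k (A i) (A (star_near i)) < euclid_dist k (A i) (A j)"
    unfolding realizable_in_def by metis
  have "card {2..n} \<le> 12 ^ k"
  proof (rule card_common_nearest_le[OF k, of "{2..n}" A "A 1"])
    fix i assume i: "i \<in> {2..n}"
    show "0 < sqdist k (A i) (A 1)"
    proof (rule ccontr)
      assume "\<not> 0 < sqdist k (A i) (A 1)"
      then have "(\<Sum>l<k. (A i l - A 1 l)\<^sup>2) = 0"
        using sum_nonneg[of "{..<k}" "\<lambda>l. (A i l - A 1 l)\<^sup>2"] by (simp add: sqdist_def)
      then have eq: "A i l = A 1 l" if "l < k" for l
        using that by (subst (asm) sum_nonneg_eq_0_iff) auto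
      \<comment> \<open>If the points \<open>i\<close> and 1 coincide, they have the same distance to any third point.\<close>
      define j where "j = (if i = 2 then 3 else 2::nat)"
      have "euclid_dist k (A i) (A j) = euclid_dist k (A 1) (A j)"
        by (simp add: euclid_dist_eq_sqrt sqdist_def eq)
      then show False
        using distinct[of i j 1 j] i n by (auto simp: j_def doubleton_eq_iff split: if_splits)
    qed
    fix j assume "j \<in> {2..n}" "i \<noteq> j"
    then show "sqdist k (A i) (A 1) < sqdist k (A i) (A j)"
      using near[of i j] i by (simp add: euclid_dist_eq_sqrt star_near_def)
  qed
  then show ?thesis by simp
qed

section \<open>General position\<close>

lemma eventually_at_zero_notin_finite:
  assumes "finite (F :: real set)"
  shows "eventually (\<lambda>t. t \<notin> F) (at 0)"
  unfolding eventually_at_topological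
proof (intro exI conjI)
  show "open (- (F - {0}))" using assms by (intro open_Compl finite_imp_closed) auto
qed auto

lemma power3_diff_eq:
  fixes i j p q :: nat
  assumes "i < j" "p < q" and eq: "(3::real) ^ j - 3 ^ i = 3 ^ q - 3 ^ p"
  shows "i = p \<and> j = q"
proof -
  have less: "(3::real) ^ j - 3 ^ i < 3 ^ q - 3 ^ p" if "i < j" "p < q" "j < q" for i j p q :: nat
  proof -
    have "(3::real) ^ Suc j \<le> 3 ^ q" and "(3::real) ^ Suc p \<le> 3 ^ q"
      using that by (intro power_increasing; simp)+
    moreover have "(0::real) < 3 ^ i" "(0::real) < 3 ^ j" "(0::real) < 3 ^ q" by simp_all
    ultimately show ?thesis unfolding power_Suc by linarith
  qed
  have "j = q"
    using less[of i j p q] less[of p q i j] assms by (cases j q rule: linorder_cases) auto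
  with eq show ?thesis by simp
qed

text \<open>Powers of 3 have distinct differences. They serve below as the speeds at which the points
  are moved, so that no two distances keep changing in the same way.\<close>
lemma power3_sqdiff_eq:
  fixes i j p q :: nat
  assumes ne: "i \<noteq> j" "p \<noteq> q" and eq: "((3::real) ^ i - 3 ^ j)\<^sup>2 = (3 ^ p - 3 ^ q)\<^sup>2"
  shows "{i, j} = {p, q}"
proof -
  have ord: "{i, j} = {p, q}"
    if "i < j" "p < q" "((3::real) ^ i - 3 ^ j)\<^sup>2 = (3 ^ p - 3 ^ q)\<^sup>2" for i j p q :: nat
  proof -
    have "(3::real) ^ i < 3 ^ j" "(3::real) ^ p < 3 ^ q" using that(1,2) by simp_all
    with that(3) have "(3::real) ^ j - 3 ^ i = 3 ^ q - 3 ^ p"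
      unfolding power2_eq_iff by linarith
    then show ?thesis using power3_diff_eq[OF that(1,2)] by simp
  qed
  have sorted: "((3::real) ^ min i j - 3 ^ max i j)\<^sup>2 = (3 ^ i - 3 ^ j)\<^sup>2" "{min i j, max i j} = {i, j}"
    for i j :: nat
    by (cases "i \<le> j"; simp add: min_def max_def power2_commute insert_commute)+
  have "{min i j, max i j} = {min p q, max p q}"
  proof (rule ord)
    show "min i j < max i j" "min p q < max p q" using ne by linarith+
  qed (simp only: sorted eq)
  then show ?thesis by (simp only: sorted)
qed

lemma sqdist_shift_first:
  assumes "k \<ge> 1"
  shows "sqdist k (\<lambda>l. x l + (if l = 0 then a else 0)) (\<lambda>l. y l + (if l = 0 then b else 0))
    = sqdist k x y + 2 * (x 0 - y 0) * (a - b) + (a - b)\<^sup>2"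
proof -
  have "sqdist k (\<lambda>l. x l + (if l = 0 then a else 0)) (\<lambda>l. y l + (if l = 0 then b else 0))
    = (\<Sum>l<k. (x l - y l)\<^sup>2 + (if l = 0 then 2 * (x 0 - y 0) * (a - b) + (a - b)\<^sup>2 else 0))"
    unfolding sqdist_def by (intro sum.cong) (auto simp: power2_eq_square algebra_simps)
  then show ?thesis using assms by (simp add: sum.distrib sqdist_def)
qed

text \<open>Only the conditions on nearest and farthest points matter: move the point \<open>i\<close> by \<open>t * 3 ^ i\<close> along the
  first coordinate. The squared distances are polynomials in \<open>t\<close> of degree 2 with pairwise
  distinct leading coefficients, so they are pairwise distinct for all sufficiently small
  \<open>t \<noteq> 0\<close>, and strict inequalities survive for small \<open>t\<close>.\<close>
lemma realizable_in_Rk_if_nearest_farthest: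
  assumes k: "k \<ge> 1" and f: "fixfree_map n f" and g: "fixfree_map n g"
    and near: "\<And>i j. i \<in> {1..n} \<Longrightarrow> j \<in> {1..n} - {i, f i} \<Longrightarrow> sqdist k (x i) (x (f i)) < sqdist k (x i) (x j)"
    and far: "\<And>i j. i \<in> {1..n} \<Longrightarrow> j \<in> {1..n} - {i, g i} \<Longrightarrow> sqdist k (x i) (x j) < sqdist k (x i) (x (g i))"
  shows "realizable_in (topspace (Euclidean_space k)) (euclid_dist k) n f g"
proof -
  define V where "V = {1..n}"
  have "finite V" by (simp add: V_def)
  define S where "S i j t = sqdist k (\<lambda>l. x i l + (if l = 0 then t * 3 ^ i else 0))
    (\<lambda>l. x j l + (if l = 0 then t * 3 ^ j else 0))" for i j t
  have S: "S i j t = sqdist k (x i) (x j) + 2 * (x i 0 - x j 0) * (3 ^ i - 3 ^ j) * t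
      + (3 ^ i - 3 ^ j)\<^sup>2 * t\<^sup>2" for i j t
    unfolding S_def sqdist_shift_first[OF k] by (simp add: power2_eq_square algebra_simps)
  have less: "eventually (\<lambda>t. S i j t < S p q t) (at 0)"
    if "sqdist k (x i) (x j) < sqdist k (x p) (x q)" for i j p q
  proof -
    have "((\<lambda>t. S p q t - S i j t) \<longlongrightarrow> S p q 0 - S i j 0) (at 0)"
      unfolding S by (intro tendsto_intros)
    then have "eventually (\<lambda>t. 0 < S p q t - S i j t) (at 0)"
      by (rule order_tendstoD) (use that in \<open>simp add: S\<close>)
    then show ?thesis by (rule eventually_mono) simp
  qed
  have distinct: "eventually (\<lambda>t. S i j t \<noteq> S p q t) (at 0)"
    if "i \<noteq> j" "p \<noteq> q" "{i, j} \<noteq> {p, q}" for i j p q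
  proof -
    define c where "c = ((3::real) ^ i - 3 ^ j)\<^sup>2 - (3 ^ p - 3 ^ q)\<^sup>2"
    define b where "b = 2 * (x i 0 - x j 0) * (3 ^ i - 3 ^ j) - 2 * (x p 0 - x q 0) * (3 ^ p - 3 ^ q)"
    define a where "a = sqdist k (x i) (x j) - sqdist k (x p) (x q)"
    have "c \<noteq> 0" using power3_sqdiff_eq[OF that(1,2)] that(3) by (auto simp: c_def)
    then have "finite {t. poly [:a, b, c:] t = 0}" by (intro poly_roots_finite) simp
    then have "eventually (\<lambda>t. poly [:a, b, c:] t \<noteq> 0) (at 0)"
      using eventually_at_zero_notin_finite by fastforce
    moreover have "poly [:a, b, c:] t = S i j t - S p q t" for t
      by (simp add: S a_def b_def c_def algebra_simps power2_eq_square)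
    ultimately show ?thesis by simp
  qed
  have "eventually (\<lambda>t.
      (\<forall>i\<in>V. \<forall>j\<in>V. \<forall>p\<in>V. \<forall>q\<in>V. i \<noteq> j \<and> p \<noteq> q \<and> {i, j} \<noteq> {p, q} \<longrightarrow> S i j t \<noteq> S p q t)
    \<and> (\<forall>i\<in>V. \<forall>j\<in>V - {i, f i}. S i (f i) t < S i j t)
    \<and> (\<forall>i\<in>V. \<forall>j\<in>V - {i, g i}. S i j t < S i (g i) t)) (at 0)"
  proof (intro eventually_conj)
    show "eventually (\<lambda>t. \<forall>i\<in>V. \<forall>j\<in>V. \<forall>p\<in>V. \<forall>q\<in>V.
        i \<noteq> j \<and> p \<noteq> q \<and> {i, j} \<noteq> {p, q} \<longrightarrow> S i j t \<noteq> S p q t) (at 0)"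
    proof (intro eventually_ball_finite ballI \<open>finite V\<close>)
      fix i j p q
      show "eventually (\<lambda>t. i \<noteq> j \<and> p \<noteq> q \<and> {i, j} \<noteq> {p, q} \<longrightarrow> S i j t \<noteq> S p q t) (at 0)"
        using distinct[of i j p q]
        by (cases "i \<noteq> j \<and> p \<noteq> q \<and> {i, j} \<noteq> {p, q}") (auto elim: eventually_mono)
    qed
    show "eventually (\<lambda>t. \<forall>i\<in>V. \<forall>j\<in>V - {i, f i}. S i (f i) t < S i j t) (at 0)"
      using near \<open>finite V\<close> by (intro eventually_ball_finite ballI less) (auto simp: V_def)
    show "eventually (\<lambda>t. \<forall>i\<in>V. \<forall>j\<in>V - {i, g i}. S i j t < S i (g i) t) (at 0)"
      using far \<open>finite V\<close> by (intro eventually_ball_finite ballI less) (auto simp: V_def)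
  qed
  then obtain t where t:
      "\<forall>i\<in>V. \<forall>j\<in>V. \<forall>p\<in>V. \<forall>q\<in>V. i \<noteq> j \<and> p \<noteq> q \<and> {i, j} \<noteq> {p, q} \<longrightarrow> S i j t \<noteq> S p q t"
      "\<forall>i\<in>V. \<forall>j\<in>V - {i, f i}. S i (f i) t < S i j t"
      "\<forall>i\<in>V. \<forall>j\<in>V - {i, g i}. S i j t < S i (g i) t"
    using eventually_happens'[OF at_neq_bot] by blast
  define A where "A i l = (if l < k then x i l + (if l = 0 then t * 3 ^ i else 0) else 0)" for i l
  have A: "euclid_dist k (A i) (A j) = sqrt (S i j t)" for i j
    by (simp add: euclid_dist_eq_sqrt S_def sqdist_def A_def)
  have "A \<in> {1..n} \<rightarrow> topspace (Euclidean_space k)"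
    by (auto simp: A_def topspace_Euclidean_space)
  then show ?thesis
    unfolding realizable_in_def using t by (intro exI[of _ A]) (simp add: A V_def)
qed

section \<open>Realizable pairs as orders on the pairs of points\<close>

text \<open>What a realization says about \<open>f\<close> and \<open>g\<close>, as a statement about the order on pairs given by \<open>D\<close>.
  Neither nonnegativity nor the triangle inequality is kept, so that the conditions are invariant under exchanging
  \<open>f\<close> with \<open>g\<close> and \<open>D\<close> with \<open>- D\<close>. This symmetry gives every fact about farthest points from the
  one about nearest points.\<close>
locale neighbour_order =
  fixes n :: nat and f g :: "nat \<Rightarrow> nat" and D :: "nat \<Rightarrow> nat \<Rightarrow> real"
  assumes n: "n \<ge> 3"
    and f: "fixfree_map n f" and g: "fixfree_map n g"
    and sym: "D i j = D j i"
    and bounded: "\<bar>D i j\<bar> \<le> 1"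
    and near: "\<lbrakk>i \<in> {1..n}; j \<in> {1..n}; j \<noteq> i; j \<noteq> f i\<rbrakk> \<Longrightarrow> D i (f i) < D i j"
    and far: "\<lbrakk>i \<in> {1..n}; j \<in> {1..n}; j \<noteq> i; j \<noteq> g i\<rbrakk> \<Longrightarrow> D i j < D i (g i)"
begin

lemma f_in: "i \<in> {1..n} \<Longrightarrow> f i \<in> {1..n}" and f_neq: "i \<in> {1..n} \<Longrightarrow> f i \<noteq> i"
  and g_in: "i \<in> {1..n} \<Longrightarrow> g i \<in> {1..n}" and g_neq: "i \<in> {1..n} \<Longrightarrow> g i \<noteq> i"
  using f g unfolding fixfree_map_def by blast+

end

lemma realizable_imp_neighbour_order:
  assumes n: "n \<ge> 3" and f: "fixfree_map n f" and g: "fixfree_map n g" and "realizable n f g"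
  shows "\<exists>D. neighbour_order n f g D"
proof -
  from \<open>realizable n f g\<close> obtain M :: "nat set" and d where "Metric_space M d" "realizable_in M d n f g"
    unfolding realizable_def by blast
  then interpret Metric_space M d by simp
  from \<open>realizable_in M d n f g\<close> obtain A where
      near: "\<forall>i\<in>{1..n}. \<forall>j\<in>{1..n} - {i, f i}. d (A i) (A (f i)) < d (A i) (A j)"
      and far: "\<forall>i\<in>{1..n}. \<forall>j\<in>{1..n} - {i, g i}. d (A i) (A (g i)) > d (A i) (A j)"
    unfolding realizable_in_def by (elim exE conjE)
  \<comment> \<open>The increasing map \<open>s \<mapsto> s / (1 + s)\<close> makes the distances bounded.\<close>
  have mono: "s / (1 + s) < t / (1 + t)" if "0 \<le> s" "s < t" for s t :: real
    using that by (simp add: divide_simps algebra_simps)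
  have "neighbour_order n f g (\<lambda>i j. d (A i) (A j) / (1 + d (A i) (A j)))"
  proof (unfold_locales)
    fix i j
    show "d (A i) (A j) / (1 + d (A i) (A j)) = d (A j) (A i) / (1 + d (A j) (A i))"
      by (simp add: commute)
    show "\<bar>d (A i) (A j) / (1 + d (A i) (A j))\<bar> \<le> 1"
    proof -
      have pos: "0 < 1 + d (A i) (A j)" by (intro add_pos_nonneg nonneg) simp
      have "0 \<le> d (A i) (A j) / (1 + d (A i) (A j))"
        by (intro divide_nonneg_pos pos nonneg)
      moreover have "d (A i) (A j) / (1 + d (A i) (A j)) \<le> 1"
        unfolding pos_divide_le_eq[OF pos] by simp
      ultimately show ?thesis by linarith
    qed
  qed (use n f g near far nonneg in \<open>auto intro!: mono\<close>)
  then show ?thesis by blast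
qed

section \<open>Three points\<close>

text \<open>Put the point that is not on the longest side between the two others.\<close>
lemma three_points_on_line:
  fixes D :: "nat \<Rightarrow> nat \<Rightarrow> real"
  assumes sym: "\<And>i j. D i j = D j i"
    and ne: "D 1 2 \<noteq> D 1 3" "D 1 2 \<noteq> D 2 3" "D 1 3 \<noteq> D 2 3"
  shows "\<exists>h :: nat \<Rightarrow> real. \<forall>i\<in>{1,2,3}. \<forall>j\<in>{1,2,3}. \<forall>l\<in>{1,2,3}.
    i \<noteq> j \<and> i \<noteq> l \<and> j \<noteq> l \<and> D i j < D i l \<longrightarrow> (h i - h j)\<^sup>2 < (h i - h l)\<^sup>2"
proof -
  define H :: "real \<Rightarrow> real \<Rightarrow> real \<Rightarrow> nat \<Rightarrow> real"
    where "H a b c i = (if i = 1 then a else if i = 2 then b else c)" for a b c i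
  note sym' = sym[of 2 "Suc 0"] sym[of 3 "Suc 0"] sym[of 3 2]
  consider "D 1 2 < D 1 3" "D 1 3 < D 2 3" | "D 1 3 < D 1 2" "D 1 2 < D 2 3"
    | "D 1 2 < D 2 3" "D 2 3 < D 1 3" | "D 2 3 < D 1 2" "D 1 2 < D 1 3"
    | "D 1 3 < D 2 3" "D 2 3 < D 1 2" | "D 2 3 < D 1 3" "D 1 3 < D 1 2"
    using ne by linarith
  then show ?thesis
  proof cases
    case 1 then show ?thesis by (intro exI[of _ "H 1 0 3"]) (simp add: H_def sym')
  next
    case 2 then show ?thesis by (intro exI[of _ "H 2 0 3"]) (simp add: H_def sym')
  next
    case 3 then show ?thesis by (intro exI[of _ "H 0 1 3"]) (simp add: H_def sym')
  next
    case 4 then show ?thesis by (intro exI[of _ "H 0 2 3"]) (simp add: H_def sym')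
  next
    case 5 then show ?thesis by (intro exI[of _ "H 0 3 1"]) (simp add: H_def sym')
  next
    case 6 then show ?thesis by (intro exI[of _ "H 0 3 2"]) (simp add: H_def sym')
  qed
qed

text \<open>In small dimensions the exponential lower bound is below 3, and this case covers them.\<close>
lemma (in neighbour_order) realizable_in_Rk_three:
  assumes k: "k \<ge> 1" and n3: "n = 3"
  shows "realizable_in (topspace (Euclidean_space k)) (euclid_dist k) n f g"
proof -
  have V: "{1..n} = {1, 2, 3::nat}" using n3 by auto
  have ne: "D i j \<noteq> D i l" if "i \<in> {1..n}" "j \<in> {1..n}" "l \<in> {1..n}" "i \<noteq> j" "i \<noteq> l" "j \<noteq> l" for i j l
  proof -
    have "f i = j \<or> f i = l" using f_in[OF that(1)] f_neq[OF that(1)] that unfolding V by auto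
    then show ?thesis using near[of i j] near[of i l] that by auto
  qed
  have "D 1 2 \<noteq> D 1 3" "D 1 2 \<noteq> D 2 3" "D 1 3 \<noteq> D 2 3"
    using ne[of 1 2 3] ne[of 2 1 3] ne[of 3 1 2] sym[of 2 1] sym[of 3 1] sym[of 3 2] n3 by auto
  from three_points_on_line[OF sym this] obtain h :: "nat \<Rightarrow> real"
    where h: "\<And>i j l. \<lbrakk>i \<in> {1..n}; j \<in> {1..n}; l \<in> {1..n}; i \<noteq> j; i \<noteq> l; j \<noteq> l; D i j < D i l\<rbrakk>
      \<Longrightarrow> (h i - h j)\<^sup>2 < (h i - h l)\<^sup>2"
    unfolding V by blast
  define x where "x i l = (if l = 0 then h i else 0)" for i l :: nat
  have x: "sqdist k (x i) (x j) = (h i - h j)\<^sup>2" for i j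
  proof -
    have "sqdist k (x i) (x j) = (\<Sum>l<k. if l = 0 then (h i - h j)\<^sup>2 else 0)"
      unfolding sqdist_def by (intro sum.cong) (auto simp: x_def)
    then show ?thesis using k by simp
  qed
  show ?thesis
  proof (rule realizable_in_Rk_if_nearest_farthest[OF k f g, of x])
    fix i j :: nat assume i: "i \<in> {1..n}"
    show "sqdist k (x i) (x (f i)) < sqdist k (x i) (x j)" if "j \<in> {1..n} - {i, f i}"
      unfolding x using h[of i "f i" j] near[of i j] f_in[OF i] f_neq[OF i] i that by auto
    show "sqdist k (x i) (x j) < sqdist k (x i) (x (g i))" if "j \<in> {1..n} - {i, g i}"
      unfolding x using h[of i j "g i"] far[of i j] g_in[OF i] g_neq[OF i] i that by auto
  qed
qed

lemma all_realizable_in_Rk_3: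
  assumes k: "k \<ge> 1"
  shows "all_realizable_in_Rk k 3"
  unfolding all_realizable_in_Rk_def
  using realizable_imp_neighbour_order[of 3] neighbour_order.realizable_in_Rk_three[OF _ k refl]
  by blast

section \<open>Nearly orthogonal directions\<close>

lemma exp_add_exp_minus_le:
  fixes t :: real
  shows "exp t + exp (- t) \<le> 2 * exp (t\<^sup>2)"
proof -
  have pos: "exp t + exp (- t) \<le> 2 * exp (t\<^sup>2)" if t: "t \<ge> 0" for t :: real
  proof (cases "t \<le> 1")
    case True
    have "exp t \<le> 1 + t + t\<^sup>2" using t True by (rule exp_bound)
    moreover have "exp (- t) \<le> 1 - t + t\<^sup>2"
    proof -
      have "1 + t + t\<^sup>2 / 2 \<le> exp t" using t by (rule exp_lower_Taylor_quadratic)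
      then have "exp (- t) \<le> inverse (1 + t + t\<^sup>2 / 2)"
        unfolding exp_minus using t by (intro le_imp_inverse_le) (auto intro: add_pos_nonneg)
      also have "\<dots> \<le> 1 - t + t\<^sup>2"
      proof -
        have "(1 - t + t\<^sup>2) * (1 + t + t\<^sup>2 / 2) = 1 + t\<^sup>2 / 2 + t ^ 3 / 2 + t ^ 4 / 2"
          by (simp add: field_simps power2_eq_square power3_eq_cube power4_eq_xxxx)
        then have "1 \<le> (1 - t + t\<^sup>2) * (1 + t + t\<^sup>2 / 2)" using t by simp
        moreover have "0 < 1 + t + t\<^sup>2 / 2" using t by (intro add_pos_nonneg) auto
        ultimately show ?thesis by (simp add: inverse_eq_divide pos_divide_le_eq)
      qed
      finally show ?thesis .
    qed
    moreover have "1 + t\<^sup>2 \<le> exp (t\<^sup>2)" by (rule exp_ge_add_one_self)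
    ultimately show ?thesis by linarith
  next
    case False
    then have "t * 1 \<le> t * t" by (intro mult_left_mono) auto
    then have "exp t \<le> exp (t\<^sup>2)" by (simp add: power2_eq_square)
    moreover have "exp (- t) \<le> exp (t\<^sup>2)" using t by (simp add: order_trans[of "- t" 0])
    ultimately show ?thesis by linarith
  qed
  show ?thesis using pos[of t] pos[of "- t"] by (cases "t \<ge> 0") (auto simp: add.commute)
qed

text \<open>A bound on the moment generating function of a random sign sum with coefficients \<open>x\<close>, multiplied by
  the number \<open>2 ^ k\<close> of sign vectors.\<close>
lemma sum_sign_exp_le:
  assumes x: "ip k x x = 1"
  shows "(\<Sum>u\<in>PiE {..<k} (\<lambda>_. {1, -1}). exp (s * ip k u x)) \<le> 2 ^ k * exp (s\<^sup>2)"
proof -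
  have "(\<Sum>u\<in>PiE {..<k} (\<lambda>_. {1, -1}). exp (s * ip k u x))
    = (\<Sum>u\<in>PiE {..<k} (\<lambda>_. {1, -1}). \<Prod>l<k. exp (s * x l * u l))"
    by (simp add: ip_def sum_distrib_left exp_sum mult_ac)
  also have "\<dots> = (\<Prod>l<k. \<Sum>e\<in>{1, -1}. exp (s * x l * e))"
    by (rule prod_sum_PiE[symmetric]) auto
  also have "\<dots> \<le> (\<Prod>l<k. 2 * exp ((s * x l)\<^sup>2))"
    using exp_add_exp_minus_le by (intro prod_mono) (auto intro: add_nonneg_nonneg)
  also have "\<dots> = 2 ^ k * exp (\<Sum>l<k. (s * x l)\<^sup>2)"
    by (simp add: prod.distrib exp_sum)
  also have "(\<Sum>l<k. (s * x l)\<^sup>2) = s\<^sup>2 * ip k x x"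
    by (simp add: ip_def sum_distrib_left power2_eq_square mult_ac)
  finally show ?thesis using x by simp
qed

text \<open>Average \<open>H u\<close>, a sum of exponentials of \<open>\<plusminus> s * ip k u (x j)\<close>, over all sign vectors \<open>u\<close>. Some
  \<open>u\<close> does not exceed the average, which bounds every single term and hence every inner product.
  The value of \<open>s\<close> is the optimal one for the threshold \<open>e * sqrt k\<close>.\<close>
lemma exists_nearly_orthogonal:
  fixes x :: "'a \<Rightarrow> nat \<Rightarrow> real"
  assumes "k \<ge> 1" "finite T" "e > 0"
    and unit: "\<forall>j\<in>T. ip k (x j) (x j) = 1"
    and card: "2 * real (card T) * exp (- (e\<^sup>2 * k / 4)) < 1"
  shows "\<exists>u. ip k u u = 1 \<and> (\<forall>j\<in>T. \<bar>ip k u (x j)\<bar> \<le> e)"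
proof -
  define U where "U = PiE {..<k} (\<lambda>_. {1, -1 :: real})"
  define s where "s = e * sqrt k / 2"
  define H where "H u = (\<Sum>j\<in>T. exp (s * ip k u (x j)) + exp (- s * ip k u (x j)))" for u
  have U: "finite U" "card U = 2 ^ k" "U \<noteq> {}"
    by (auto simp: U_def card_PiE finite_PiE PiE_eq_empty_iff numeral_2_eq_2)
  have s2: "s\<^sup>2 = e\<^sup>2 * k / 4" by (simp add: s_def power_divide power_mult_distrib)
  have "(\<Sum>u\<in>U. H u) = (\<Sum>j\<in>T. (\<Sum>u\<in>U. exp (s * ip k u (x j))) + (\<Sum>u\<in>U. exp (- s * ip k u (x j))))"
    unfolding H_def by (subst sum.swap) (simp add: sum.distrib)
  also have "\<dots> \<le> (\<Sum>j\<in>T. 2 ^ k * exp (s\<^sup>2) + 2 ^ k * exp (s\<^sup>2))"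
    using unit sum_sign_exp_le[of k _ s] sum_sign_exp_le[of k _ "- s"]
    by (intro sum_mono add_mono) (auto simp: U_def)
  also have "\<dots> = (\<Sum>u\<in>U. 2 * real (card T) * exp (s\<^sup>2))"
    using U by simp
  finally have "\<exists>u\<in>U. H u \<le> 2 * real (card T) * exp (s\<^sup>2)"
    using sum_strict_mono[OF U(1,3), of "\<lambda>_. 2 * real (card T) * exp (s\<^sup>2)" H] by (meson not_le)
  then obtain v where v: "v \<in> U" "H v \<le> 2 * real (card T) * exp (s\<^sup>2)" by blast
  have "2 * real (card T) * exp (s\<^sup>2) < exp (2 * s\<^sup>2)"
  proof -
    have "(2 * real (card T) * exp (- s\<^sup>2)) * exp (2 * s\<^sup>2) < 1 * exp (2 * s\<^sup>2)"
      using card by (intro mult_strict_right_mono) (simp_all add: s2)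
    then show ?thesis unfolding mult.assoc exp_add[symmetric] by simp
  qed
  with v have Hv: "H v < exp (2 * s\<^sup>2)" by linarith
  have v_small: "\<bar>ip k v (x j)\<bar> \<le> e * sqrt k" if "j \<in> T" for j
  proof -
    have "exp (s * ip k v (x j)) + exp (- s * ip k v (x j)) \<le> H v"
      unfolding H_def using that \<open>finite T\<close> by (intro member_le_sum) (auto intro: add_nonneg_nonneg)
    then have "exp (s * ip k v (x j)) < exp (2 * s\<^sup>2)" "exp (- s * ip k v (x j)) < exp (2 * s\<^sup>2)"
      using Hv exp_gt_zero[of "s * ip k v (x j)"] exp_gt_zero[of "- s * ip k v (x j)"] by linarith+
    then have "s * ip k v (x j) < s * (2 * s)" "s * - ip k v (x j) < s * (2 * s)"
      by (simp_all add: power2_eq_square)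
    moreover have "s > 0" using assms by (simp add: s_def)
    ultimately have "ip k v (x j) < 2 * s" "- ip k v (x j) < 2 * s"
      by (simp_all only: mult_less_cancel_left_pos)
    then show ?thesis by (simp add: s_def)
  qed
  define u where "u l = (1 / sqrt k) * v l" for l
  have "v l * v l = 1" if "l < k" for l
    using PiE_mem[OF v(1)[unfolded U_def], of l] that by auto
  then have "ip k v v = k" by (simp add: ip_def)
  moreover have "ip k u u = 1 / sqrt k * (1 / sqrt k * ip k v v)"
    unfolding u_def by (subst ip_scale_left, subst ip_commute, subst ip_scale_left) (rule refl)
  ultimately have "ip k u u = 1" using \<open>k \<ge> 1\<close> by (simp flip: real_sqrt_mult)
  moreover have "\<bar>ip k u (x j)\<bar> \<le> e" if "j \<in> T" for j
    using v_small[OF that] \<open>k \<ge> 1\<close> unfolding u_def ip_scale_left by (simp add: abs_mult divide_simps)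
  ultimately show ?thesis by blast
qed

section \<open>Prescribed inner products\<close>

text \<open>The Neumann series \<open>c = b - E b + E (E b) - ...\<close>, whose terms \<open>e t\<close> decrease by a factor of 2.\<close>
lemma diagonally_dominant_solvable:
  fixes E :: "'a \<Rightarrow> 'a \<Rightarrow> real"
  assumes E: "\<And>l. l \<in> N \<Longrightarrow> (\<Sum>m\<in>N. \<bar>E l m\<bar>) \<le> 1 / 2"
    and b: "\<And>l. l \<in> N \<Longrightarrow> \<bar>b l\<bar> \<le> B"
  shows "\<exists>c. \<forall>l\<in>N. c l + (\<Sum>m\<in>N. E l m * c m) = b l \<and> \<bar>c l\<bar> \<le> 2 * B"
proof -
  define e where "e = rec_nat b (\<lambda>_ r l. - (\<Sum>m\<in>N. E l m * r m))"
  have e_0: "e 0 = b" and e_Suc: "e (Suc t) l = - (\<Sum>m\<in>N. E l m * e t m)" for t l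
    by (simp_all add: e_def)
  have bound: "\<bar>e t l\<bar> \<le> B * (1/2) ^ t" if "l \<in> N" for t l
    using that
  proof (induction t arbitrary: l)
    case 0
    then show ?case using b by (simp add: e_0)
  next
    case (Suc t)
    have "0 \<le> B * (1/2) ^ t" using Suc.IH[OF Suc.prems] by linarith
    have "\<bar>e (Suc t) l\<bar> \<le> (\<Sum>m\<in>N. \<bar>E l m * e t m\<bar>)"
      unfolding e_Suc abs_minus_cancel by (rule sum_abs)
    also have "\<dots> \<le> (\<Sum>m\<in>N. \<bar>E l m\<bar> * (B * (1/2) ^ t))"
      using Suc.IH by (intro sum_mono) (auto simp: abs_mult intro: mult_left_mono)
    also have "\<dots> = (\<Sum>m\<in>N. \<bar>E l m\<bar>) * (B * (1/2) ^ t)"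
      by (simp add: sum_distrib_right)
    also have "\<dots> \<le> 1 / 2 * (B * (1/2) ^ t)"
      using E[OF Suc.prems] \<open>0 \<le> B * (1/2) ^ t\<close> by (rule mult_right_mono)
    finally show ?case by simp
  qed
  define c where "c l = (\<Sum>t. e t l)" for l
  have geom: "(\<lambda>t. B * (1/2) ^ t) sums (2 * B)"
    using sums_mult[OF geometric_sums[of "1/2::real"], of B] by (simp add: mult.commute[of 2])
  have summable: "summable (\<lambda>t. e t l)" if "l \<in> N" for l
    using bound[OF that] geom by (intro summable_comparison_test'[OF sums_summable[OF geom], of 0]) auto
  then have sums: "(\<lambda>t. e t l) sums c l" if "l \<in> N" for l
    using that unfolding c_def by (intro summable_sums)
  show ?thesis
  proof (intro exI[of _ c] ballI conjI)
    fix l assume l: "l \<in> N"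
    have "(\<lambda>t. \<Sum>m\<in>N. E l m * e t m) sums (\<Sum>m\<in>N. E l m * c m)"
      using sums by (intro sums_sum sums_mult)
    then have "(\<lambda>t. e (Suc t) l) sums (- (\<Sum>m\<in>N. E l m * c m))"
      unfolding e_Suc by (rule sums_minus)
    then have "(\<lambda>t. e t l) sums (- (\<Sum>m\<in>N. E l m * c m) + b l)"
      by (subst (asm) sums_Suc_iff) (simp add: e_0)
    with sums[OF l] have "c l = - (\<Sum>m\<in>N. E l m * c m) + b l" by (rule sums_unique2)
    then show "c l + (\<Sum>m\<in>N. E l m * c m) = b l" by simp
    have "c l \<le> 2 * B" using bound[OF l] by (intro sums_le[OF _ sums[OF l] geom]) (simp add: abs_le_iff)
    moreover have "- c l \<le> 2 * B"
      using bound[OF l] by (intro sums_le[OF _ sums_minus[OF sums[OF l]] geom]) (simp add: abs_le_iff)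
    ultimately show "\<bar>c l\<bar> \<le> 2 * B" by linarith
  qed
qed

text \<open>The Gram matrix of at most eight nearly orthonormal vectors is diagonally dominant, so any
  prescribed inner products with them are attained by a combination with small coefficients.\<close>
lemma span_prescribed_ip:
  fixes x :: "'a \<Rightarrow> nat \<Rightarrow> real"
  assumes "finite N" "card N \<le> 8" "0 \<le> d" "d \<le> 1 / 16"
    and unit: "\<forall>j\<in>N. ip k (x j) (x j) = 1"
    and small: "\<forall>i\<in>N. \<forall>j\<in>N. i \<noteq> j \<longrightarrow> \<bar>ip k (x i) (x j)\<bar> \<le> d"
    and b: "\<forall>l\<in>N. \<bar>b l\<bar> \<le> B"
  shows "\<exists>c. (\<forall>l\<in>N. ip k (\<lambda>q. \<Sum>m\<in>N. c m * x m q) (x l) = b l) \<and> (\<forall>l\<in>N. \<bar>c l\<bar> \<le> 2 * B)"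
proof -
  define E where "E l m = (if m = l then 0 else ip k (x m) (x l))" for l m
  have "(\<Sum>m\<in>N. \<bar>E l m\<bar>) \<le> 1 / 2" if "l \<in> N" for l
  proof -
    have "(\<Sum>m\<in>N. \<bar>E l m\<bar>) \<le> (\<Sum>m\<in>N. 1 / 16)"
    proof (rule sum_mono)
      fix m assume "m \<in> N"
      then have "m \<noteq> l \<Longrightarrow> \<bar>ip k (x m) (x l)\<bar> \<le> d" using small that by blast
      then show "\<bar>E l m\<bar> \<le> 1 / 16" using assms(4) by (auto simp: E_def)
    qed
    also have "\<dots> \<le> 1 / 2" using assms(2) by simp
    finally show ?thesis .
  qed
  then obtain c where c: "\<And>l. l \<in> N \<Longrightarrow> c l + (\<Sum>m\<in>N. E l m * c m) = b l"
      "\<And>l. l \<in> N \<Longrightarrow> \<bar>c l\<bar> \<le> 2 * B"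
    using diagonally_dominant_solvable[of N E b B] b by blast
  have "ip k (\<lambda>q. \<Sum>m\<in>N. c m * x m q) (x l) = b l" if l: "l \<in> N" for l
  proof -
    have "(\<Sum>m\<in>N. c m * ip k (x m) (x l)) = (\<Sum>m\<in>N. (if m = l then c m else 0) + E l m * c m)"
      using unit l by (intro sum.cong) (auto simp: E_def)
    also have "\<dots> = c l + (\<Sum>m\<in>N. E l m * c m)"
      using l \<open>finite N\<close> by (simp add: sum.distrib)
    finally show ?thesis using c(1)[OF l] by (simp add: ip_sum_left)
  qed
  with c(2) show ?thesis by blast
qed

lemma abs_sum_mult_le:
  fixes c :: "'a \<Rightarrow> real"
  assumes "card N \<le> 8" "0 \<le> C" "0 \<le> d"
    and c: "\<And>m. m \<in> N \<Longrightarrow> \<bar>c m\<bar> \<le> C" and y: "\<And>m. m \<in> N \<Longrightarrow> \<bar>y m\<bar> \<le> d"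
  shows "\<bar>\<Sum>m\<in>N. c m * y m\<bar> \<le> 8 * (C * d)"
proof -
  have "\<bar>\<Sum>m\<in>N. c m * y m\<bar> \<le> (\<Sum>m\<in>N. \<bar>c m * y m\<bar>)" by (rule sum_abs)
  also have "\<dots> \<le> (\<Sum>m\<in>N. C * d)"
    using c y assms by (intro sum_mono) (auto simp: abs_mult intro: mult_mono)
  also have "\<dots> \<le> 8 * (C * d)"
    using assms by (auto intro: mult_right_mono)
  finally show ?thesis .
qed

text \<open>Let \<open>u\<close> be nearly orthogonal to all given vectors. The new vector is \<open>v + \<beta> z\<close>, where \<open>v\<close> lies in
  the span of the constrained vectors and has the prescribed inner products with them, \<open>z\<close> is \<open>u\<close>
  corrected to be orthogonal to that span, and \<open>\<beta>\<close> normalizes the length. The coefficients of \<open>v\<close>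
  are of the order \<open>\<delta> = 1 / 320\<close>, as are the inner products of distinct given vectors, so
  that \<open>v\<close> contributes at most \<open>16 \<delta>\<^sup>2 = \<delta> / 20\<close> to the inner products without
  constraint; \<open>u\<close> is chosen with accuracy \<open>\<delta> / 40\<close> to make the total at most \<open>\<delta> / 10\<close>.\<close>
lemma extend_prescribed_ip:
  fixes x :: "'a \<Rightarrow> nat \<Rightarrow> real"
  assumes "k \<ge> 1" "finite T" "N \<subseteq> T" "card N \<le> 8"
    and unit: "\<forall>j\<in>T. ip k (x j) (x j) = 1"
    and small: "\<forall>i\<in>T. \<forall>j\<in>T. i \<noteq> j \<longrightarrow> \<bar>ip k (x i) (x j)\<bar> \<le> 1 / 320"
    and a: "\<forall>l\<in>N. \<bar>a l\<bar> \<le> 1 / 320"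
    and card: "2 * real (card T) * exp (- ((1 / 12800)\<^sup>2 * k / 4)) < 1"
  shows "\<exists>y. ip k y y = 1 \<and> (\<forall>l\<in>N. ip k y (x l) = a l) \<and> (\<forall>j\<in>T - N. \<bar>ip k y (x j)\<bar> \<le> 1 / 3200)"
proof -
  have finN: "finite N" using assms(2,3) by (rule finite_subset[rotated])
  have "(0::real) < 1 / 12800" by simp
  from exists_nearly_orthogonal[OF assms(1,2) this unit card]
  obtain u where u: "ip k u u = 1" "\<And>j. j \<in> T \<Longrightarrow> \<bar>ip k u (x j)\<bar> \<le> 1 / 12800"
    by blast
  have N: "\<And>j. j \<in> N \<Longrightarrow> j \<in> T" using assms(3) by blast
  have d: "(0::real) \<le> 1 / 320" "1 / 320 \<le> (1 / 16 :: real)" by simp_all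
  have "\<forall>j\<in>N. ip k (x j) (x j) = 1" "\<forall>i\<in>N. \<forall>j\<in>N. i \<noteq> j \<longrightarrow> \<bar>ip k (x i) (x j)\<bar> \<le> 1 / 320"
    using unit small N by auto
  note span = span_prescribed_ip[OF finN assms(4) d this]
  obtain c where c: "\<And>l. l \<in> N \<Longrightarrow> ip k (\<lambda>q. \<Sum>m\<in>N. c m * x m q) (x l) = a l"
      "\<And>l. l \<in> N \<Longrightarrow> \<bar>c l\<bar> \<le> 2 * (1 / 320)"
    using span[OF a] by blast
  have "\<forall>l\<in>N. \<bar>ip k u (x l)\<bar> \<le> 1 / 12800" using u(2) N by blast
  from span[OF this] obtain c' where c': "\<And>l. l \<in> N \<Longrightarrow> ip k (\<lambda>q. \<Sum>m\<in>N. c' m * x m q) (x l) = ip k u (x l)"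
      "\<And>l. l \<in> N \<Longrightarrow> \<bar>c' l\<bar> \<le> 2 * (1 / 12800)"
    by blast
  define v where "v = (\<lambda>q. \<Sum>m\<in>N. c m * x m q)"
  define w where "w = (\<lambda>q. \<Sum>m\<in>N. c' m * x m q)"
  define z where "z = (\<lambda>q. u q - w q)"
  have v_x: "ip k v (x l) = a l" and z_x: "ip k z (x l) = 0" if "l \<in> N" for l
    using c(1)[OF that] c'(1)[OF that] by (simp_all add: v_def w_def z_def ip_diff_left)
  have ip_v: "ip k v q = (\<Sum>m\<in>N. c m * ip k (x m) q)"
    and ip_w: "ip k w q = (\<Sum>m\<in>N. c' m * ip k (x m) q)" for q
    by (simp_all add: v_def w_def ip_sum_left)
  have vz: "ip k v z = 0" and wz: "ip k w z = 0"
    using z_x ip_commute[of k z] by (simp_all add: ip_v ip_w)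
  have "ip k v v = (\<Sum>m\<in>N. c m * a m)"
    unfolding ip_v[of v] using v_x ip_commute[of k v] by (intro sum.cong) auto
  then have "\<bar>ip k v v\<bar> \<le> 8 * (2 * (1 / 320) * (1 / 320))"
    using abs_sum_mult_le[OF assms(4), of "2 * (1 / 320)" "1 / 320" c a] c(2) a by simp
  then have vv: "0 \<le> ip k v v" "ip k v v \<le> 1"
    using ip_nonneg by auto
  have "ip k w u = (\<Sum>m\<in>N. c' m * ip k u (x m))"
    unfolding ip_w using ip_commute[of k u] by (intro sum.cong) auto
  then have "\<bar>ip k w u\<bar> \<le> 8 * (2 * (1 / 12800) * (1 / 12800))"
    using abs_sum_mult_le[OF assms(4), of "2 * (1 / 12800)" "1 / 12800" c' "\<lambda>m. ip k u (x m)"] c'(2) u(2) N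
    by simp
  moreover have "ip k z z = 1 - ip k w u"
  proof -
    have "ip k z z = ip k u z - ip k w z" unfolding z_def by (rule ip_diff_left)
    also have "\<dots> = ip k z u" by (simp add: wz ip_commute)
    also have "\<dots> = 1 - ip k w u" by (simp add: z_def ip_diff_left u)
    finally show ?thesis .
  qed
  ultimately have zz: "1 / 2 \<le> ip k z z" by linarith
  define \<beta> where "\<beta> = sqrt ((1 - ip k v v) / ip k z z)"
  have \<beta>2: "\<beta>\<^sup>2 = (1 - ip k v v) / ip k z z" using vv zz by (simp add: \<beta>_def)
  have "\<beta>\<^sup>2 \<le> 1 / (1 / 2)" unfolding \<beta>2 using vv zz by (intro frac_le) auto
  then have "\<beta>\<^sup>2 \<le> (3 / 2)\<^sup>2" by (simp add: power2_eq_square)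
  then have "\<beta> \<le> 3 / 2" by (rule power2_le_imp_le) simp
  moreover have "0 \<le> \<beta>" using vv zz by (simp add: \<beta>_def)
  ultimately have \<beta>: "0 \<le> \<beta>" "\<beta> \<le> 3 / 2" by simp_all
  define y where "y = (\<lambda>q. v q + \<beta> * z q)"
  have ip_y: "ip k y q = ip k v q + \<beta> * ip k z q" for q
    unfolding y_def by (simp add: ip_add_left ip_scale_left)
  show ?thesis
  proof (intro exI[of _ y] conjI ballI)
    have "ip k y y = ip k v y + \<beta> * ip k z y" by (rule ip_y)
    also have "\<dots> = ip k v v + \<beta>\<^sup>2 * ip k z z"
      using vz by (simp add: ip_commute[of k _ y] ip_y ip_commute[of k z v] power2_eq_square)
    also have "\<dots> = 1" using zz by (simp add: \<beta>2)
    finally show "ip k y y = 1" .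
    show "ip k y (x l) = a l" if "l \<in> N" for l
      using that by (simp add: ip_y v_x z_x)
  next
    fix j assume j: "j \<in> T - N"
    have xj: "\<bar>ip k (x m) (x j)\<bar> \<le> 1 / 320" if "m \<in> N" for m
    proof -
      have "m \<noteq> j" using that j by blast
      then show ?thesis using that j N small by blast
    qed
    have "\<bar>ip k v (x j)\<bar> \<le> 8 * (2 * (1 / 320) * (1 / 320))"
      unfolding ip_v using abs_sum_mult_le[OF assms(4), of "2 * (1 / 320)" "1 / 320" c] c(2) xj by simp
    moreover have "\<bar>ip k w (x j)\<bar> \<le> 8 * (2 * (1 / 12800) * (1 / 320))"
      unfolding ip_w using abs_sum_mult_le[OF assms(4), of "2 * (1 / 12800)" "1 / 320" c'] c'(2) xj by simp
    moreover have "\<bar>ip k u (x j)\<bar> \<le> 1 / 12800" using j u(2) by auto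
    ultimately have v_small: "\<bar>ip k v (x j)\<bar> \<le> 1 / 6400" and z_small: "\<bar>ip k z (x j)\<bar> \<le> 1 / 12000"
      unfolding z_def ip_diff_left by linarith+
    have "\<bar>\<beta> * ip k z (x j)\<bar> \<le> 3 / 2 * (1 / 12000)"
      unfolding abs_mult using \<beta> z_small by (intro mult_mono) auto
    with v_small show "\<bar>ip k y (x j)\<bar> \<le> 1 / 3200" unfolding ip_y by linarith
  qed
qed

lemma exists_small_in_degree:
  fixes out :: "'a \<Rightarrow> 'a set"
  assumes "finite S" "S \<noteq> {}" and out: "\<forall>i\<in>S. finite (out i) \<and> card (out i) \<le> d"
  shows "\<exists>v\<in>S. card {i \<in> S. v \<in> out i} \<le> d"
proof -
  have "(\<Sum>v\<in>S. card {i \<in> S. v \<in> out i}) = (\<Sum>i\<in>S. card {v \<in> S. v \<in> out i})"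
    using sum.swap_restrict[OF assms(1,1), of "\<lambda>_ _. 1::nat" "\<lambda>v i. v \<in> out i"] by simp
  also have "\<dots> \<le> (\<Sum>i\<in>S. d)"
  proof (rule sum_mono)
    fix i assume "i \<in> S"
    then have "card {v \<in> S. v \<in> out i} \<le> card (out i)" using out by (intro card_mono) auto
    with out \<open>i \<in> S\<close> show "card {v \<in> S. v \<in> out i} \<le> d" by fastforce
  qed
  finally have "\<not> (\<forall>v\<in>S. d < card {i \<in> S. v \<in> out i})"
    using sum_strict_mono[OF assms(1,2), of "\<lambda>_. d" "\<lambda>v. card {i \<in> S. v \<in> out i}"] by auto
  then show ?thesis by (auto simp: not_less)
qed

text \<open>Remove a vertex \<open>v\<close> with at most four incoming edges, place the others by induction, and
  then place \<open>v\<close>: it has at most \<open>4 + 4\<close> neighbours.\<close>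
lemma exists_points_prescribed_ip:
  fixes W :: "'a \<Rightarrow> 'a \<Rightarrow> real"
  assumes "finite S" "k \<ge> 1"
    and out: "\<forall>i\<in>S. finite (out i) \<and> card (out i) \<le> 4"
    and W: "\<And>i j. W i j = W j i" "\<And>i j. \<bar>W i j\<bar> \<le> 1"
    and card: "2 * real (card S) * exp (- ((1 / 12800)\<^sup>2 * k / 4)) < 1"
  shows "\<exists>x :: 'a \<Rightarrow> nat \<Rightarrow> real. (\<forall>i\<in>S. ip k (x i) (x i) = 1) \<and>
    (\<forall>i\<in>S. \<forall>j\<in>S. i \<noteq> j \<longrightarrow>
      (if j \<in> out i \<or> i \<in> out j then ip k (x i) (x j) = W i j / 320
       else \<bar>ip k (x i) (x j)\<bar> \<le> 1 / 3200))"
  using assms(1) out card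
proof (induction "card S" arbitrary: S)
  case 0
  then show ?case by auto
next
  case (Suc s)
  have "S \<noteq> {}" using Suc.hyps(2) by auto
  then obtain v where v: "v \<in> S" "card {i \<in> S. v \<in> out i} \<le> 4"
    using exists_small_in_degree[OF Suc.prems(1) _ Suc.prems(2)] by blast
  define T where "T = S - {v}"
  have "card T = card S - 1" unfolding T_def by (rule card_Diff_singleton[OF v(1)])
  then have T: "finite T" "card T = s" "card T \<le> card S" "T \<subseteq> S" "v \<notin> T"
    using Suc.hyps(2) Suc.prems(1) by (simp_all add: T_def)
  have cardT: "2 * real (card T) * exp (- ((1 / 12800)\<^sup>2 * k / 4)) < 1"
  proof -
    have "2 * real (card T) * exp (- ((1 / 12800)\<^sup>2 * k / 4)) \<le> 2 * real (card S) * exp (- ((1 / 12800)\<^sup>2 * k / 4))"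
      using T(3) by (intro mult_right_mono mult_left_mono) auto
    with Suc.prems(3) show ?thesis by linarith
  qed
  have "\<forall>i\<in>T. finite (out i) \<and> card (out i) \<le> 4" using T(4) Suc.prems(2) by blast
  from Suc.hyps(1)[OF T(2)[symmetric] T(1) this cardT]
  obtain x :: "'a \<Rightarrow> nat \<Rightarrow> real" where "(\<forall>i\<in>T. ip k (x i) (x i) = 1) \<and>
    (\<forall>i\<in>T. \<forall>j\<in>T. i \<noteq> j \<longrightarrow>
      (if j \<in> out i \<or> i \<in> out j then ip k (x i) (x j) = W i j / 320
       else \<bar>ip k (x i) (x j)\<bar> \<le> 1 / 3200))" ..
  then have unit: "\<forall>i\<in>T. ip k (x i) (x i) = 1" and "\<forall>i\<in>T. \<forall>j\<in>T. i \<noteq> j \<longrightarrow>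
      (if j \<in> out i \<or> i \<in> out j then ip k (x i) (x j) = W i j / 320
       else \<bar>ip k (x i) (x j)\<bar> \<le> 1 / 3200)" by (rule conjunct1, rule conjunct2)
  note x = this(2)[THEN bspec, THEN bspec, THEN mp]
  define N where "N = {j \<in> T. j \<in> out v \<or> v \<in> out j}"
  have "card N \<le> card (out v \<union> {i \<in> S. v \<in> out i})"
    using Suc.prems(1,2) v(1) T(4) by (intro card_mono) (auto simp: N_def)
  also have "\<dots> \<le> 4 + 4"
    using card_Un_le[of "out v" "{i \<in> S. v \<in> out i}"] v Suc.prems(2) by (meson add_mono order_trans)
  finally have cardN: "card N \<le> 8" by simp
  have "\<bar>ip k (x i) (x j)\<bar> \<le> 1 / 320" if "i \<in> T" "j \<in> T" "i \<noteq> j" for i j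
    using x[OF that] W(2)[of i j] by (auto split: if_splits)
  then have small: "\<forall>i\<in>T. \<forall>j\<in>T. i \<noteq> j \<longrightarrow> \<bar>ip k (x i) (x j)\<bar> \<le> 1 / 320" by blast
  have "N \<subseteq> T" by (auto simp: N_def)
  have "\<forall>l\<in>N. \<bar>W v l / 320\<bar> \<le> 1 / 320" using W(2) by simp
  from extend_prescribed_ip[OF assms(2) T(1) \<open>N \<subseteq> T\<close> cardN unit small this cardT]
  obtain y where y: "ip k y y = 1" "\<And>l. l \<in> N \<Longrightarrow> ip k y (x l) = W v l / 320"
    "\<And>j. j \<in> T - N \<Longrightarrow> \<bar>ip k y (x j)\<bar> \<le> 1 / 3200" by blast
  have y': "if j \<in> out v \<or> v \<in> out j then ip k y (x j) = W v j / 320 else \<bar>ip k y (x j)\<bar> \<le> 1 / 3200"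
    if "j \<in> T" for j
    using y(2,3)[of j] that by (auto simp: N_def)
  define x' where "x' = x(v := y)"
  have x': "x' v = y" "\<And>i. i \<in> T \<Longrightarrow> x' i = x i" using T(5) by (auto simp: x'_def)
  show ?case
  proof (intro exI[of _ x'] conjI ballI impI)
    fix i assume "i \<in> S"
    then have i: "i = v \<or> i \<in> T" by (auto simp: T_def)
    then show "ip k (x' i) (x' i) = 1" using y(1) unit x' by auto
    fix j assume "j \<in> S" "i \<noteq> j"
    then have j: "j = v \<and> i \<in> T \<or> j \<in> T \<and> (i = v \<or> i \<in> T)" using i by (auto simp: T_def)
    then show "if j \<in> out i \<or> i \<in> out j then ip k (x' i) (x' j) = W i j / 320
       else \<bar>ip k (x' i) (x' j)\<bar> \<le> 1 / 3200"
      using y'[of i] y'[of j] x[of i j] x' \<open>i \<noteq> j\<close> W(1)[of i j] ip_commute[of k "x i" y]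
      by (elim disjE conjE) (auto split: if_splits)
  qed
qed

section \<open>Inner products that encode the order\<close>

text \<open>Such an \<open>i\<close> is the end of an edge that is shortest at \<open>i\<close> and longest at \<open>f i\<close>. The
  other end satisfies the condition with \<open>f\<close> and \<open>g\<close> exchanged, \<open>source g f\<close>.\<close>
definition source :: "(nat \<Rightarrow> nat) \<Rightarrow> (nat \<Rightarrow> nat) \<Rightarrow> nat \<Rightarrow> bool" where
  "source f g i \<longleftrightarrow> g (f i) = i"

text \<open>The prescribed inner products in units of \<open>\<delta>\<close>. For \<open>\<bar>D\<bar> \<le> 1\<close> the values on \<open>f\<close>-edges lie in
  \<open>[1 / 2, 1]\<close>, and those on \<open>g\<close>-edges in \<open>[- 1, - 1 / 2]\<close>; both decrease in \<open>D\<close>. The levels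
  \<open>\<plusminus> 1 / 4\<close> are for the other pairs at the ends of the exceptional edge, which must lie between the
  exceptional edge and the \<open>f\<close>-edges and \<open>g\<close>-edges. All remaining pairs stay within \<open>1 / 10\<close> of 0.\<close>
definition weight :: "(nat \<Rightarrow> nat) \<Rightarrow> (nat \<Rightarrow> nat) \<Rightarrow> (nat \<Rightarrow> nat \<Rightarrow> real) \<Rightarrow> nat \<Rightarrow> nat \<Rightarrow> real" where
  "weight f g D i j =
    (if source f g i \<and> f i = j \<or> source f g j \<and> f j = i then 0
     else if f i = j \<or> f j = i then (3 - D i j) / 4
     else if g i = j \<or> g j = i then - ((3 + D i j) / 4)
     else if source g f i \<or> source g f j then 1 / 4
     else if source f g i \<or> source f g j then - (1 / 4)
     else 0)"

text \<open>The orientation of the graph of pairs whose inner products have to be exact: every vertex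
  points to its nearest and farthest points and to the two ends of the exceptional edge, if there is one.\<close>
definition targets :: "nat \<Rightarrow> (nat \<Rightarrow> nat) \<Rightarrow> (nat \<Rightarrow> nat) \<Rightarrow> nat \<Rightarrow> nat set" where
  "targets n f g i = {f i, g i} \<union> {j \<in> {1..n}. source f g j} \<union> {j \<in> {1..n}. source g f j}"

lemma targets_dual: "targets n g f i = targets n f g i"
  by (auto simp: targets_def)

context neighbour_order
begin

lemma dual: "neighbour_order n g f (\<lambda>i j. - D i j)"
proof (rule neighbour_order.intro)
  fix i j
  show "- D i j = - D j i" by (simp only: sym[of i j])
  show "\<bar>- D i j\<bar> \<le> 1" using bounded[of i j] by simp
  assume ij: "i \<in> {1..n}" "j \<in> {1..n}" "j \<noteq> i"
  show "- D i (g i) < - D i j" if "j \<noteq> g i" using far[OF ij that] by simp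
  show "- D i j < - D i (f i)" if "j \<noteq> f i" using near[OF ij that] by simp
qed (rule n f g)+

lemma nearest_neq_farthest:
  assumes i: "i \<in> {1..n}"
  shows "f i \<noteq> g i"
proof
  assume eq: "f i = g i"
  have "\<not> {1..n} \<subseteq> {i, f i}"
  proof
    assume "{1..n} \<subseteq> {i, f i}"
    then have "card {1..n} \<le> card {i, f i}" by (intro card_mono) auto
    also have "\<dots> \<le> 2" by (simp add: card_insert_if)
    finally show False using n by simp
  qed
  then obtain j where "j \<in> {1..n}" "j \<noteq> i" "j \<noteq> f i" by blast
  with near[OF i this] far[OF i, of j] eq show False by simp
qed

text \<open>For sources \<open>i\<close> and \<open>i'\<close> with edges to \<open>j = f i\<close> and \<open>j' = f i'\<close>, the edge between \<open>i\<close> and \<open>j'\<close> is at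
  least as long as the first one, since it starts at \<open>i\<close>, and at most as long as the second one,
  since it ends at \<open>j'\<close>. By symmetry each of the two edges would be the shorter one. If \<open>i\<close> and \<open>j'\<close>
  coincide, the argument with \<open>i\<close> and \<open>i'\<close> exchanged still shows that \<open>i'\<close> is closer to \<open>i\<close> than
  \<open>f i\<close> is, although \<open>i'\<close> is farthest from \<open>i\<close>.\<close>
lemma source_unique:
  assumes i: "i \<in> {1..n}" "source f g i" and i': "i' \<in> {1..n}" "source f g i'"
  shows "i = i'"
proof (rule ccontr)
  assume "i \<noteq> i'"
  have less: "D i (f i) < D i' (f i')"
    if i: "i \<in> {1..n}" "source f g i" and i': "i' \<in> {1..n}" "source f g i'"
      and "i \<noteq> i'" "f i' \<noteq> i" for i i'
  proof -
    have "f i \<noteq> f i'" using that by (auto simp: source_def)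
    then have "D i (f i) < D i (f i')"
      using that f_in by (intro near) auto
    also have "\<dots> = D (f i') i" by (rule sym)
    also have "\<dots> < D (f i') (g (f i'))"
      using that f_in by (intro far) (auto simp: source_def)
    also have "\<dots> = D i' (f i')" using i' sym by (simp add: source_def)
    finally show ?thesis .
  qed
  have disjoint: False if i: "i \<in> {1..n}" "source f g i" and i': "i' \<in> {1..n}" "source f g i'"
      and "i \<noteq> i'" "f i' = i" for i i'
  proof -
    have gi: "g i = i'" using that by (auto simp: source_def)
    then have "f i \<noteq> i'" using nearest_neq_farthest[OF i(1)] by auto
    then have "D i' (f i') < D i (f i)"
      using less[OF i' i] that by auto
    moreover have "D i (f i) < D i (g i)"
      using f_in f_neq nearest_neq_farthest i(1) by (intro far) auto
    ultimately show False using that gi sym by simp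
  qed
  have "f i' \<noteq> i" "f i \<noteq> i'"
    using disjoint[OF i i' \<open>i \<noteq> i'\<close>] disjoint[OF i' i \<open>i \<noteq> i'\<close>[symmetric]] by auto
  then show False using less[OF i i'] less[OF i' i] \<open>i \<noteq> i'\<close> by simp
qed

lemma card_sources_le: "card {j \<in> {1..n}. source f g j} \<le> 1"
  using source_unique by (simp add: card_le_Suc0_iff_eq)

lemma card_targets_le: "finite (targets n f g i) \<and> card (targets n f g i) \<le> 4"
proof -
  have "card (targets n f g i) \<le> card {f i, g i} + card {j \<in> {1..n}. source f g j} + card {j \<in> {1..n}. source g f j}"
    unfolding targets_def by (intro order_trans[OF card_Un_le] add_mono order_refl)
  also have "\<dots> \<le> 2 + 1 + 1"
    using card_sources_le neighbour_order.card_sources_le[OF dual]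
    by (intro add_mono) (auto simp: card_insert_if)
  finally show ?thesis by (simp add: targets_def)
qed

text \<open>Otherwise \<open>D j i < D j (f i) < D i (f i) < D i j\<close>, where the second step holds because \<open>i\<close> is
  farthest from \<open>f i\<close>.\<close>
lemma source_not_nearest:
  assumes i: "i \<in> {1..n}" "source f g i" and j: "j \<in> {1..n}" "j \<noteq> f i"
  shows "f j \<noteq> i"
proof
  assume fj: "f j = i"
  have ne: "j \<noteq> i" "f i \<noteq> i" using f_neq i j fj by auto
  have "D j (f j) < D j (f i)" using i j ne fj f_in by (intro near) auto
  also have "\<dots> = D (f i) j" by (rule sym)
  also have "\<dots> < D (f i) (g (f i))" using i j ne f_in by (intro far) (auto simp: source_def)
  also have "\<dots> = D i (f i)" using i sym by (simp add: source_def)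
  also have "\<dots> < D i j" using i j ne by (intro near) auto
  finally show False using fj sym by simp
qed

lemma weight_dual:
  assumes ij: "i \<in> {1..n}" "j \<in> {1..n}" "i \<noteq> j"
  shows "weight g f (\<lambda>i j. - D i j) i j = - weight f g D i j"
proof -
  have bridge: "source g f i \<and> g i = j \<or> source g f j \<and> g j = i \<longleftrightarrow>
      source f g i \<and> f i = j \<or> source f g j \<and> f j = i"
    by (auto simp: source_def)
  have both: "source f g i \<and> f i = j \<or> source f g j \<and> f j = i"
    if "f i = j \<or> f j = i" "g i = j \<or> g j = i"
    using that nearest_neq_farthest[OF ij(1)] nearest_neq_farthest[OF ij(2)] by (auto simp: source_def)
  have linked: "f i = j \<or> f j = i" if "source g f i \<or> source g f j" "source f g i \<or> source f g j"
  proof -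
    have "f r = s" if "source f g r" "source g f s" "r \<in> {1..n}" "s \<in> {1..n}" for r s
    proof -
      have "source g f (f r)" using that by (simp add: source_def)
      then show ?thesis using neighbour_order.source_unique[OF dual] that f_in by blast
    qed
    then show ?thesis using that ij f_neq by metis
  qed
  have cases: "(if b then 0 else if G then (3 - - d) / 4 else if F then - ((3 + - d) / 4)
      else if R then 1 / 4 else if S then - (1 / 4) else 0)
    = - (if b then 0 else if F then (3 - d) / 4 else if G then - ((3 + d) / 4)
      else if S then 1 / 4 else if R then - (1 / 4) else (0::real))"
    if "F \<Longrightarrow> G \<Longrightarrow> b" "S \<Longrightarrow> R \<Longrightarrow> F" for b F G R S and d :: real
    using that by (cases b; cases F; cases G; cases R; cases S) simp_all
  show ?thesis
    unfolding weight_def bridge by (rule cases[OF both linked])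
qed

lemma weight_sym: "weight f g D i j = weight f g D j i"
  unfolding weight_def sym[of j i] by (simp only: disj_commute)

lemma abs_weight_le: "\<bar>weight f g D i j\<bar> \<le> 1"
  using bounded[of i j] unfolding weight_def by (simp add: abs_le_iff)

text \<open>If \<open>{i, j}\<close> is not a prescribed pair, its inner product is only known to be within \<open>1 / 10\<close> of
  0; this is what the second claim is for. If \<open>i\<close> is a source, then its edge to \<open>f i\<close> has
  weight 0, but all other pairs at \<open>i\<close> are prescribed and negative. Otherwise that edge has weight at least
  \<open>1 / 2\<close>, which only the other \<open>f\<close>-edges reach, and those at \<open>i\<close> are longer.\<close>
lemma weight_nearest:
  assumes i: "i \<in> {1..n}" and j: "j \<in> {1..n}" "j \<noteq> i" "j \<noteq> f i"
  shows "weight f g D i j < weight f g D i (f i)"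
    and "\<not> (j \<in> targets n f g i \<or> i \<in> targets n f g j) \<Longrightarrow> 1 / 4 \<le> weight f g D i (f i)"
proof -
  have "weight f g D i j < weight f g D i (f i) \<and>
    (\<not> (j \<in> targets n f g i \<or> i \<in> targets n f g j) \<longrightarrow> 1 / 4 \<le> weight f g D i (f i))"
  proof (cases "source f g i")
    case True
    have fj: "f j \<noteq> i" using source_not_nearest[OF i True j(1,3)] .
    have "source g f (f i)" using True by (simp add: source_def)
    then have "\<not> source g f j"
      using neighbour_order.source_unique[OF dual, of j "f i"] j f_in[OF i] by blast
    moreover have "\<not> source g f i"
      using source_not_nearest[OF i True g_in[OF i]] nearest_neq_farthest[OF i] by (auto simp: source_def)
    moreover have "weight f g D i (f i) = 0" using True by (simp add: weight_def)
    moreover have "- 1 \<le> D i j" using bounded[of i j] by (simp add: abs_le_iff)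
    ultimately have "weight f g D i j < weight f g D i (f i)"
      using True fj j(3) by (simp add: weight_def)
    moreover have "i \<in> targets n f g j" using True i by (simp add: targets_def)
    ultimately show ?thesis by blast
  next
    case False
    have "\<not> (source f g (f i) \<and> f (f i) = i)"
      using nearest_neq_farthest[OF f_in[OF i]] nearest_neq_farthest[OF i] by (auto simp: source_def)
    with False have wf: "weight f g D i (f i) = (3 - D i (f i)) / 4" by (auto simp: weight_def)
    have le: "D i (f i) \<le> 1" using bounded[of i "f i"] by (simp add: abs_le_iff)
    have cases: "(if b then 0 else if F then (3 - e) / 4 else if G then - ((3 + e) / 4)
        else if S then 1 / 4 else if R then - (1 / 4) else 0) < (3 - d) / 4"
      if "d < e" "d \<le> 1" "- 1 \<le> e" for b F G S R and d e :: real
      using that by (cases b; cases F; cases G; cases S; cases R) (simp_all add: field_simps)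
    have "- 1 \<le> D i j" using bounded[of i j] by (simp add: abs_le_iff)
    then have "weight f g D i j < (3 - D i (f i)) / 4"
      unfolding weight_def by (intro cases near[OF i j] le)
    with wf le show ?thesis by simp
  qed
  then show "weight f g D i j < weight f g D i (f i)"
    and "\<not> (j \<in> targets n f g i \<or> i \<in> targets n f g j) \<Longrightarrow> 1 / 4 \<le> weight f g D i (f i)" by blast+
qed

lemma realizable_in_Rk_log_dim:
  assumes k: "k \<ge> 1" and large: "2 * real n * exp (- ((1 / 12800)\<^sup>2 * k / 4)) < 1"
  shows "realizable_in (topspace (Euclidean_space k)) (euclid_dist k) n f g"
proof -
  let ?W = "weight f g D"
  have "2 * real (card {1..n}) * exp (- ((1 / 12800)\<^sup>2 * k / 4)) < 1" using large by simp
  from exists_points_prescribed_ip[where out = "targets n f g" and W = ?W,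
      OF finite_atLeastAtMost k ballI[OF card_targets_le] weight_sym abs_weight_le this]
  obtain x where x: "(\<forall>i\<in>{1..n}. ip k (x i) (x i) = 1) \<and>
    (\<forall>i\<in>{1..n}. \<forall>j\<in>{1..n}. i \<noteq> j \<longrightarrow>
      (if j \<in> targets n f g i \<or> i \<in> targets n f g j then ip k (x i) (x j) = ?W i j / 320
       else \<bar>ip k (x i) (x j)\<bar> \<le> 1 / 3200))" ..
  note unit = x[THEN conjunct1, THEN bspec] and pair = x[THEN conjunct2, THEN bspec, THEN bspec, THEN mp]
  have linked: "ip k (x i) (x j) = ?W i j / 320"
    if "i \<in> {1..n}" "j \<in> {1..n}" "i \<noteq> j" "j \<in> targets n f g i \<or> i \<in> targets n f g j" for i j
    using pair[OF that(1-3)] that(4) by (simp only: if_True)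
  have unlinked: "\<bar>ip k (x i) (x j)\<bar> \<le> 1 / 3200"
    if "i \<in> {1..n}" "j \<in> {1..n}" "i \<noteq> j" "\<not> (j \<in> targets n f g i \<or> i \<in> targets n f g j)" for i j
    using pair[OF that(1-3)] that(4) by (simp only: if_False)
  show ?thesis
  proof (rule realizable_in_Rk_if_nearest_farthest[OF k f g, of x])
    fix i j assume i: "i \<in> {1..n}"
    show "sqdist k (x i) (x (f i)) < sqdist k (x i) (x j)" if "j \<in> {1..n} - {i, f i}"
    proof -
      have j: "j \<in> {1..n}" "j \<noteq> i" "j \<noteq> f i" using that by auto
      have "ip k (x i) (x (f i)) = ?W i (f i) / 320"
        using i f_in[OF i] f_neq[OF i] by (intro linked) (auto simp: targets_def)
      then have "ip k (x i) (x j) < ip k (x i) (x (f i))"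
        using weight_nearest[OF i j] linked[of i j] unlinked[of i j] i j
        by (cases "j \<in> targets n f g i \<or> i \<in> targets n f g j") auto
      then show ?thesis using i j f_in by (simp add: sqdist_eq_ip unit)
    qed
    show "sqdist k (x i) (x j) < sqdist k (x i) (x (g i))" if "j \<in> {1..n} - {i, g i}"
    proof -
      have j: "j \<in> {1..n}" "j \<noteq> i" "j \<noteq> g i" using that by auto
      have "ip k (x i) (x (g i)) = ?W i (g i) / 320"
        using i g_in[OF i] g_neq[OF i] by (intro linked) (auto simp: targets_def)
      moreover have "?W i (g i) < ?W i j"
        and "\<not> (j \<in> targets n f g i \<or> i \<in> targets n f g j) \<Longrightarrow> ?W i (g i) \<le> - 1 / 4"
        using neighbour_order.weight_nearest[OF dual i j] i j g_in[OF i] g_neq[OF i]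
        by (simp_all add: weight_dual targets_dual)
      ultimately have "ip k (x i) (x (g i)) < ip k (x i) (x j)"
        using linked[of i j] unlinked[of i j] i j
        by (cases "j \<in> targets n f g i \<or> i \<in> targets n f g j") auto
      then show ?thesis using i j g_in by (simp add: sqdist_eq_ip unit)
    qed
  qed
qed

end

lemma all_realizable_in_Rk_log_dim:
  assumes "k \<ge> 1" "n \<ge> 3" "2 * real n * exp (- ((1 / 12800)\<^sup>2 * k / 4)) < 1"
  shows "all_realizable_in_Rk k n"
  unfolding all_realizable_in_Rk_def
  using realizable_imp_neighbour_order[OF assms(2)] neighbour_order.realizable_in_Rk_log_dim[OF _ assms(1,3)]
    assms(2) by blast

section \<open>Exponential growth\<close>

theorem theorem2:
  shows "\<exists>A B c C :: real. A > 0 \<and> B > 0 \<and> c > 1 \<and> C > 1 \<and>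
    (\<forall>k::nat. k \<ge> 1 \<longrightarrow>
       (all_realizable_in_Rk k (m k) \<and> (\<forall>n. all_realizable_in_Rk k n \<longrightarrow> n \<le> m k)) \<and>
       A * c ^ k < real (m k) \<and> real (m k) < B * C ^ k)"
proof -
  define c :: real where "c = exp ((1 / 12800)\<^sup>2 / 4)"
  have c_pow: "c ^ k = exp ((1 / 12800)\<^sup>2 * k / 4)" for k
    unfolding c_def exp_of_nat_mult[symmetric] by (simp add: mult.commute)
  have "all_realizable_in_Rk k (m k) \<and> (\<forall>n. all_realizable_in_Rk k n \<longrightarrow> n \<le> m k) \<and>
    1 / 8 * c ^ k < real (m k) \<and> real (m k) < 2 * 12 ^ k" if k: "k \<ge> 1" for k
  proof -
    have bounded: "\<And>n. all_realizable_in_Rk k n \<Longrightarrow> n \<le> 12 ^ k + 1"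
      using all_realizable_in_Rk_le[OF k] .
    have attained: "all_realizable_in_Rk k (m k)"
      unfolding m_def using all_realizable_in_Rk_3[OF k] bounded by (rule GreatestI_nat)
    have greatest: "n \<le> m k" if "all_realizable_in_Rk k n" for n
      unfolding m_def using that bounded by (rule Greatest_le_nat)
    have "1 / 8 * c ^ k < real (m k)"
    proof (cases "c ^ k / 8 < 3")
      case True
      then show ?thesis using greatest[OF all_realizable_in_Rk_3[OF k]] by simp
    next
      case False
      \<comment> \<open>The largest \<open>n\<close> allowed by the condition \<open>2 * n < c ^ k\<close> is about \<open>c ^ k / 2\<close>; the factor 4
        leaves room for strictness.\<close>
      define n where "n = nat \<lfloor>c ^ k / 4\<rfloor>"
      have n: "c ^ k / 4 - 1 < real n" "real n \<le> c ^ k / 4"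
        using False by (simp_all add: n_def) linarith+
      have "2 * real n < c ^ k" using n(2) False by simp
      then have "2 * real n * exp (- ((1 / 12800)\<^sup>2 * k / 4)) < 1"
        by (simp add: c_pow exp_minus divide_simps)
      moreover have "n \<ge> 3" using n(1) False by linarith
      ultimately have "n \<le> m k" using k by (intro greatest all_realizable_in_Rk_log_dim)
      then show ?thesis using n(1) False by simp
    qed
    moreover have "real (m k) < 2 * 12 ^ k"
    proof -
      have "(12::nat) ^ 1 \<le> 12 ^ k" using k by (intro power_increasing) auto
      then have "m k < 2 * 12 ^ k" using bounded[OF attained] by simp
      then have "real (m k) < real (2 * 12 ^ k)" by (simp only: of_nat_less_iff)
      then show ?thesis by simp
    qed
    ultimately show ?thesis using attained greatest by blast
  qed
  moreover have "1 < c" by (simp add: c_def)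
  ultimately show ?thesis
    by (intro exI[of _ "1/8"] exI[of _ 2] exI[of _ c] exI[of _ 12]) auto
qed

end
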